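(* Let $\nu>-1$, $\nu\neq0$. The function $f_{\nu}(z)=\left(2^{\nu}\Gamma(\nu+1)J_{\nu}(z)\right)^{1/\nu}$ is uniformly convex in the open unit disk $U$ if and only if $\nu>\nu_{1}\simeq1.4426\ldots$, where $\nu_{1}$ is the unique root of the equation $$\nu(3\nu-2)\left(J_{\nu}(1)\right)^{2}+\nu(4\nu-5)J_{\nu}(1)J_{\nu-1}(1)+2(1-\nu)\left(J_{\nu-1}(1)\right)^{2}=0$$ situated in $(\nu^{\ast},\infty)$, where $\nu^{\ast}\simeq0.39001\ldots$ is the root of the equation (in $\nu$) $J_{\nu}'(1)=0$.
   Context: $J_\nu$ is the Bessel function of the first kind of order $\nu$: $J_{\nu}(z)=\sum_{n\ge 0}\frac{(-1)^{n}}{n!\,\Gamma(n+\nu+1)}\left(\frac z2\right)^{2n+\nu}$; $J_\nu'$ is its derivative in $z$. The normalized function is $f_\nu(z)=\left(2^{\nu}\Gamma(\nu+1)J_{\nu}(z)\right)^{1/\nu}=z-\frac{1}{4\nu(\nu+1)}z^{3}+\dots$, i.e. $f_\nu(z)=z\,\left(2^\nu\Gamma(\nu+1)z^{-\nu}J_\nu(z)\right)^{1/\nu}$, with the branch of the power equal to $1$ at $z=0$. $U=\{z\in\mathbb C:|z|<1\}$. A function $f(z)=z+\sum_{n\ge2}a_nz^n$ is uniformly convex in $U$ if it is analytic in $U$, convex there (univalent with convex image), and for every circular arc $\gamma$ contained in $U$ with center also in $U$, the arc $f(\gamma)$ is convex. Equivalently (Rønning's characterization), $f$ is analytic in $U$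 and $\operatorname{Re}\left(1+\frac{zf''(z)}{f'(z)}\right)>\left|\frac{zf''(z)}{f'(z)}\right|$ for all $z\in U$.
   Formalization: The condition "ν > ν₁" is corrected to "ν ≥ ν₁": at ν = ν₁ one has |z f''/f'| < 1/2 throughout the open disk U, so f_{ν₁} is uniformly convex and the printed strict inequality fails at that single point. *)

theory Defs
  imports "HOL-Complex_Analysis.Complex_Analysis"
begin

(* rGamma is the entire function 1/Gamma. The power is the principal one, so the
   slit is the negative real axis. Since 0 powr a = 0 in HOL, the value at z = 0 is
   always 0; for \<nu> = 0 this differs from the usual J_0(0) = 1. *)
definition bessel_J :: "real \<Rightarrow> complex \<Rightarrow> complex" where
  "bessel_J \<nu> z =
     (\<Sum>n. (-1) ^ n / fact n * rGamma (of_nat n + of_real \<nu> + 1)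
            * (z / 2) powr (2 * of_nat n + of_real \<nu>))"

(* "f is the function f_\<nu> on the unit disc". The quantity 2^\<nu> \<Gamma>(\<nu>+1) z^(-\<nu>) J_\<nu>(z) is the
   restriction to z \<noteq> 0 of an entire function with value 1 at z = 0, so near 0 the
   principal power is the branch that equals 1 at z = 0. On the rest of the disc f is the
   analytic continuation of this germ. Such an f is unique on the disc if it exists;
   for \<nu> close to -1 the zeros of J_\<nu> inside the disc may prevent its existence. *)
definition is_bessel_f :: "real \<Rightarrow> (complex \<Rightarrow> complex) \<Rightarrow> bool" where
  "is_bessel_f \<nu> f \<longleftrightarrow>
     f holomorphic_on ball 0 1 \<and>
     (\<forall>\<^sub>F z in nhds 0.
        f z = z * (2 powr of_real \<nu> * Gamma (of_real \<nu> + 1) * z powr (- of_real \<nu>)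
                   * bessel_J \<nu> z) powr (1 / of_real \<nu>))"

(* A regular parametrized arc is convex if the argument of its tangent (a continuous
   branch of it) is nondecreasing along the arc. *)
definition convex_arc :: "(real \<Rightarrow> complex) \<Rightarrow> real \<Rightarrow> real \<Rightarrow> bool" where
  "convex_arc w a b \<longleftrightarrow>
     (\<exists>w' \<theta>.
        (\<forall>t\<in>{a..b}. (w has_vector_derivative w' t) (at t within {a..b}) \<and>
                     w' t \<noteq> 0 \<and> w' t = of_real (norm (w' t)) * cis (\<theta> t)) \<and>
        continuous_on {a..b} \<theta> \<and> mono_on {a..b} \<theta>)"

(* Goodman's definition. The circular arcs are traversed counterclockwise. *)
definition uniformly_convex :: "(complex \<Rightarrow> complex) \<Rightarrow> bool" where
  "uniformly_convex f \<longleftrightarrow>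
     f holomorphic_on ball 0 1 \<and> f 0 = 0 \<and> deriv f 0 = 1 \<and>
     inj_on f (ball 0 1) \<and> convex (f ` ball 0 1) \<and>
     (\<forall>\<zeta> r a b. \<zeta> \<in> ball 0 1 \<and> r > 0 \<and> a < b \<and> b \<le> a + 2 * pi \<and>
        (\<forall>t\<in>{a..b}. \<zeta> + of_real r * cis t \<in> ball 0 1)
        \<longrightarrow> convex_arc (\<lambda>t. f (\<zeta> + of_real r * cis t)) a b)"

definition nu1_equation :: "real \<Rightarrow> bool" where
  "nu1_equation \<nu> \<longleftrightarrow>
     of_real (\<nu> * (3 * \<nu> - 2)) * (bessel_J \<nu> 1)\<^sup>2
     + of_real (\<nu> * (4 * \<nu> - 5)) * bessel_J \<nu> 1 * bessel_J (\<nu> - 1) 1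
     + of_real (2 * (1 - \<nu>)) * (bessel_J (\<nu> - 1) 1)\<^sup>2 = 0"

end

(* Write J_nu(z) = (z/2)^nu / Gamma(nu+1) * Phi(z^2) and P = -2 s Phi'/Phi as a function of s = z^2,
   so that z J_nu'/J_nu = nu - P. Bessel's equation becomes the Riccati equation
   2 s P' + 2 nu P = P^2 + s, whose power series solution has, for nu > 0, nonnegative coefficients
   that decrease in nu; it converges beyond the unit disc. With f = f_nu the Riccati equation gives
     z f''/f' = - (P/nu + 2 s P' / (nu - P)),
   so on the unit disc |f''/f'| is at most C(nu), the value of the bracket at s = 1, provided that
   P(1) < nu. The bound |f''/f'| <= 1/2 forces uniform convexity, because two points of the disc
   have distance less than 2; conversely, uniform convexity applied to an arc through z centred at -z
   gives Re (z f''/f') >= -1/2, and z -> 1 along the reals yields P(1) < nu and C(nu) <= 1/2.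
   Since C is strictly decreasing, the condition is nu >= nu1, where C(nu1) = 1/2; this equation is
   the one in the theorem, and P(1) = nu is the equation J_nu'(1) = 0.
   For -1 < nu < 0 the inequality Re (z f''/f') >= -1/2 fails on the imaginary axis. *)
theory Submission
  imports Defs
begin

section \<open>Convex images and convex arcs\<close>

text \<open>P is also twice the sum of s/(j^2 - s) over the positive zeros j of J_\<nu>. Signs and
  monotonicity of the coefficients are taken from the Riccati recursion instead, so no expansion
  over the zeros is required. Nonnegative coefficients make the triangle inequality sharp at s = 1.
  This is why a sufficient bound on a modulus and a necessary bound on a real part meet in the same
  number C(\<nu>): the extremal arc has its centre near -1 and passes near 1, where both |z -
  \<zeta>| and |f''/f'| approach their bounds. The endpoint \<nu>1 belongs to the range because the
  disc is open: |z - \<zeta>| < 2 strictly, so |f''/f'| \<le> 1/2 still gives Re (1 + (z - \<zeta>)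
  f''/f') > 0. Two obstacles shape the proof. Uniform convexity is taken in its geometric form, so
  univalence and convexity of the image need their own arguments. And f_\<nu> is given only as a
  germ at 0, so its basic identity is stated without denominators and continued over the
  disc.\<close>

lemma second_deriv_pos_no_local_max:
  fixes h h' :: "real \<Rightarrow> real"
  assumes "e > 0" and h: "\<And>u. \<bar>u - u0\<bar> < e \<Longrightarrow> (h has_real_derivative h' u) (at u)"
    and h': "(h' has_real_derivative c) (at u0)" and "c > 0"
    and max: "\<And>u. \<bar>u - u0\<bar> < e \<Longrightarrow> h u \<le> h u0"
  shows False
proof -
  have "h' u0 = 0"
    using DERIV_local_max[OF h[of u0] \<open>e > 0\<close>] max \<open>e > 0\<close> by (simp add: abs_minus_commute)
  then obtain d where d: "d > 0" "\<And>k. 0 < k \<Longrightarrow> k < d \<Longrightarrow> h' (u0 + k) > 0"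
    using DERIV_pos_inc_right[OF h' \<open>c > 0\<close>] by auto
  define k where "k = min d e / 2"
  have k: "k > 0" "k < d" "k < e" using d \<open>e > 0\<close> by (auto simp: k_def min_def)
  have "h u0 < h (u0 + k)"
  proof (rule DERIV_pos_imp_increasing_open[where f = h])
    show "\<exists>y. (h has_real_derivative y) (at x) \<and> 0 < y" if "u0 < x" "x < u0 + k" for x
      using h[of x] d(2)[of "x - u0"] that k by (intro exI[of _ "h' x"]) auto
    have "isCont h x" if "x \<in> {u0..u0 + k}" for x
      using DERIV_isCont[OF h[of x]] that k by auto
    then show "continuous_on {u0..u0 + k} h"
      by (intro continuous_at_imp_continuous_on) auto
  qed (use k in auto)
  then show False using max[of "u0 + k"] k by auto
qed

text \<open>Let \<open>g\<close> be the inverse of \<open>f\<close>. Along a segment, every critical point of \<open>|g|\<^sup>2\<close> away from its zero is a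
  strict local minimum: there \<open>(g \<circ> w)' = \<i> y g\<close> with \<open>y\<close> real, and the second derivative is a positive
  multiple of \<open>Re (1 + z f''/f')\<close>. So \<open>|g|\<close> has no interior maximum.\<close>

lemma segment_stays_inside:
  fixes f :: "complex \<Rightarrow> complex"
  assumes holf: "f holomorphic_on ball 0 1" and inj: "inj_on f (ball 0 1)"
    and convex: "\<And>z. z \<in> ball 0 1 \<Longrightarrow> Re (1 + z * deriv (deriv f) z / deriv f z) > 0"
    and "r < 1" "a \<in> ball 0 r" "b \<in> ball 0 r"
    and in_cball: "\<And>u. u \<in> {0..1} \<Longrightarrow> f a + of_real u * (f b - f a) \<in> f ` cball 0 r"
    and u0: "u0 \<in> {0..1}"
  shows "f a + of_real u0 * (f b - f a) \<in> f ` ball 0 r"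
proof (rule ccontr)
  assume notin: "f a + of_real u0 * (f b - f a) \<notin> f ` ball 0 r"
  have r0: "r > 0" using \<open>a \<in> ball 0 r\<close> by (metis dist_0_norm mem_ball norm_ge_zero order_le_less_trans)
  let ?B = "ball (0::complex) 1"
  have sub: "cball 0 r \<subseteq> ?B" "ball 0 r \<subseteq> ?B" using \<open>r < 1\<close> by auto
  obtain g where holg: "g holomorphic_on f ` ?B"
    and g1: "\<And>z. z \<in> ?B \<Longrightarrow> deriv f z * deriv g (f z) = 1"
    and g2: "\<And>z. z \<in> ?B \<Longrightarrow> g (f z) = z"
    using holomorphic_has_inverse[OF holf open_ball inj] by blast
  have open_im: "open (f ` ?B)" by (rule open_mapping_thm3[OF holf open_ball inj])
  define d where "d = f b - f a"
  define w where "w u = f a + of_real u * d" for u :: real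
  have w_deriv: "(w has_vector_derivative d) (at u)" for u
    unfolding w_def by (auto intro!: derivative_eq_intros has_vector_derivative_real_field)
  obtain z where z: "z \<in> cball 0 r" "w u0 = f z"
    using in_cball[OF u0] by (auto simp: w_def d_def)
  with notin have "z \<notin> ball 0 r" by (auto simp: w_def d_def)
  with z have nz: "norm z = r" by auto
  have zB: "z \<in> ?B" using z sub by auto
  have gw: "g (w u0) = z" using z g2 zB by auto
  have "u0 \<noteq> 0" "u0 \<noteq> 1"
    using assms(5,6) notin by (auto simp: w_def)
  then have u01: "0 < u0" "u0 < 1" using u0 by auto
  have dn0: "d \<noteq> 0"
    using notin assms(5) by (auto simp: d_def)
  define e where "e = min u0 (1 - u0)"
  have e: "e > 0" using u01 by (auto simp: e_def)
  have in01: "u \<in> {0..1}" if "\<bar>u - u0\<bar> < e" for u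
    using that by (auto simp: e_def abs_less_iff)
  have w_in: "w u \<in> f ` ?B" if "\<bar>u - u0\<bar> < e" for u
    using in_cball[OF in01[OF that]] sub unfolding w_def d_def by blast
  define k k1 k2 where "k u = g (w u)" and "k1 u = d * deriv g (w u)"
    and "k2 u = d * (d * deriv (deriv g) (w u))" for u
  have holg': "deriv g holomorphic_on f ` ?B" using holg open_im by (rule holomorphic_deriv)
  have k: "(k has_vector_derivative k1 u) (at u)" if "\<bar>u - u0\<bar> < e" for u
    using field_vector_diff_chain_at[OF w_deriv holomorphic_derivI[OF holg open_im w_in[OF that]]]
    by (simp add: k_def[abs_def] k1_def o_def)
  have k1: "(k1 has_vector_derivative k2 u) (at u)" if "\<bar>u - u0\<bar> < e" for u
    using has_vector_derivative_mult_right[OF field_vector_diff_chain_at[OF w_deriv holomorphic_derivI[OF holg' open_im w_in[OF that]]], of d]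
    by (simp add: k1_def[abs_def] k2_def o_def)
  define h where "h u = k u \<bullet> k u" for u
  define h' where "h' u = 2 * (k u \<bullet> k1 u)" for u
  have h: "(h has_real_derivative h' u) (at u)" if "\<bar>u - u0\<bar> < e" for u
    using bounded_bilinear.has_vector_derivative[OF bounded_bilinear_inner k[OF that] k[OF that]]
    by (simp add: h_def[abs_def] h'_def has_real_derivative_iff_has_vector_derivative inner_commute)
  define c where "c = 2 * (k1 u0 \<bullet> k1 u0 + k u0 \<bullet> k2 u0)"
  have h': "(h' has_real_derivative c) (at u0)"
    using has_vector_derivative_mult_right[OF
        bounded_bilinear.has_vector_derivative[OF bounded_bilinear_inner k[of u0] k1[of u0]], of 2] e
    by (simp add: h'_def[abs_def] c_def has_real_derivative_iff_has_vector_derivative inner_commute add.commute)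
  have max: "h u \<le> h u0" if u: "\<bar>u - u0\<bar> < e" for u
  proof -
    obtain y where y: "y \<in> cball 0 r" "w u = f y"
      using in_cball[OF in01[OF u]] by (auto simp: w_def d_def)
    then have "k u = y" using g2 sub by (auto simp: k_def)
    moreover have "norm y \<le> r" using y by auto
    ultimately have "(norm (k u))\<^sup>2 \<le> r\<^sup>2" by (intro power_mono) auto
    then show ?thesis by (simp add: h_def dot_square_norm k_def gw nz)
  qed
  have "h' u0 = 0"
    using DERIV_local_max[OF h[of u0] e] max e by (simp add: abs_minus_commute)
  then have orth: "z \<bullet> k1 u0 = 0" by (simp add: h'_def k_def gw)
  have f'z: "deriv f z \<noteq> 0" using g1[OF zB] by auto
  have g'z: "deriv g (f z) = 1 / deriv f z" using g1[OF zB] f'z by (simp add: field_simps)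
  \<comment> \<open>Differentiate \<open>deriv f x * deriv g (f x) = 1\<close>; this brings in
    f''/f'.\<close>
  have g''z: "deriv (deriv g) (f z) = - deriv (deriv f) z / deriv f z * (deriv g (f z))\<^sup>2"
  proof -
    have holf': "deriv f holomorphic_on ?B" by (rule holomorphic_deriv[OF holf open_ball])
    have "((\<lambda>x. deriv f x * deriv g (f x)) has_field_derivative
       deriv (deriv f) z * deriv g (f z) + deriv f z * (deriv (deriv g) (f z) * deriv f z)) (at z)"
      using DERIV_mult[OF holomorphic_derivI[OF holf' open_ball zB]
          DERIV_chain2[OF holomorphic_derivI[OF holg' open_im] holomorphic_derivI[OF holf open_ball zB]]] zB
      by (simp add: algebra_simps)
    moreover have "((\<lambda>x. deriv f x * deriv g (f x)) has_field_derivative 0) (at z)"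
      by (rule has_field_derivative_transform_within_open[OF DERIV_const[of 1] open_ball zB])
         (use g1 in auto)
    ultimately have "deriv (deriv f) z * deriv g (f z) + deriv f z * (deriv (deriv g) (f z) * deriv f z) = 0"
      by (rule DERIV_unique)
    then show ?thesis using f'z unfolding g'z
      by (simp add: field_simps power2_eq_square add_eq_0_iff)
  qed
  define q where "q = deriv (deriv f) z / deriv f z"
  \<comment> \<open>This minus sign and the one in (\<i> y)^2 cancel below, so that c becomes a
    multiple of Re (1 + z q).\<close>
  have k2: "k2 u0 = - q * (k1 u0)\<^sup>2"
    by (simp add: k2_def k1_def z(2) g''z q_def power2_eq_square)
  have z0: "z \<noteq> 0" using nz r0 by auto
  define y where "y = Im (k1 u0 / z)"
  have "Re (k1 u0 / z) = 0"
    using orth by (simp add: Re_divide inner_complex_def mult.commute)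
  then have "k1 u0 / z = \<i> * of_real y" by (simp add: y_def complex_eq_iff)
  then have k1: "k1 u0 = \<i> * of_real y * z" using z0 by (simp add: field_simps)
  have "k1 u0 \<noteq> 0" using dn0 f'z by (simp add: k1_def z(2) g'z)
  then have y0: "y \<noteq> 0" using k1 by auto
  have "k1 u0 \<bullet> k1 u0 = y\<^sup>2 * r\<^sup>2"
    by (simp add: k1 dot_square_norm norm_mult nz power_mult_distrib)
  moreover have "k u0 \<bullet> k2 u0 = y\<^sup>2 * r\<^sup>2 * Re (z * q)"
  proof -
    have "k2 u0 = y\<^sup>2 *\<^sub>R (q * z * z)"
      by (simp add: k2 k1 power_mult_distrib scaleR_conv_of_real) (simp add: power2_eq_square)
    then have "k u0 \<bullet> k2 u0 = y\<^sup>2 * (z \<bullet> (q * z * z))"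
      by (simp add: k_def gw)
    also have "z \<bullet> (q * z * z) = (norm z)\<^sup>2 * Re (z * q)"
      unfolding cmod_power2 by (simp add: inner_complex_def power2_eq_square algebra_simps)
    finally show ?thesis using nz by simp
  qed
  ultimately have "c = 2 * (y\<^sup>2 * r\<^sup>2) * Re (1 + z * q)" by (simp add: c_def algebra_simps)
  moreover have "y\<^sup>2 * r\<^sup>2 > 0" using y0 r0 by simp
  moreover have "Re (1 + z * q) > 0" using convex[OF zB] by (simp add: q_def)
  ultimately have "c > 0" by simp
  then show False
    using second_deriv_pos_no_local_max[OF e h h' _ max] by blast
qed

text \<open>By continuity in \<open>t\<close>: the set of \<open>t\<close> for which the segment from \<open>f(ta)\<close> to \<open>f(tb)\<close> lies in
  the image of a slightly smaller disc is open, and it is closed by the preceding lemma.\<close>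

lemma convex_image_ball:
  fixes f :: "complex \<Rightarrow> complex"
  assumes holf: "f holomorphic_on ball 0 1" and inj: "inj_on f (ball 0 1)"
    and convex: "\<And>z. z \<in> ball 0 1 \<Longrightarrow> Re (1 + z * deriv (deriv f) z / deriv f z) > 0"
  shows "convex (f ` ball 0 1)"
proof -
  let ?B = "ball (0::complex) 1"
  have "f a + of_real u * (f b - f a) \<in> f ` ?B"
    if ab: "a \<in> ?B" "b \<in> ?B" and u: "u \<in> {0..1}" for a b u
  proof -
    define r where "r = (1 + max (norm a) (norm b)) / 2"
    have r: "r < 1" "norm a < r" "norm b < r" "r > 0"
      using ab norm_ge_zero[of a] by (auto simp: r_def max_def) (smt (verit) norm_ge_zero field_sum_of_halves)+
    have scaled: "of_real t * x \<in> ball 0 r" if "norm x < r" "t \<in> {0..1}" for t :: real and x :: complex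
      using that mult_left_le_one_le[of "norm x" t] by (auto simp: norm_mult)
    have sub: "cball 0 r \<subseteq> ?B" "ball 0 r \<subseteq> ?B" using \<open>r < 1\<close> by auto
    \<comment> \<open>For fixed t, s (t, u) runs along the segment between the images of t a and t
      b. At t = 0 it is the constant f 0, at t = 1 the segment in question.\<close>
    define s where "s = (\<lambda>(t::real, u::real). f (of_real t * a) + of_real u * (f (of_real t * b) - f (of_real t * a)))"
    have conts: "continuous_on ({0..1} \<times> {0..1}) s"
    proof -
      have "continuous_on ({0..1} \<times> {0..1}) (\<lambda>p. f (of_real (fst p) * x))" if "norm x < r" for x
      proof (rule continuous_on_compose2[OF holomorphic_on_imp_continuous_on[OF holf]])
        show "(\<lambda>p. of_real (fst p) * x) ` ({0..1} \<times> {0..1}) \<subseteq> ?B"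
          using scaled[OF that] sub by fastforce
      qed (intro continuous_intros)
      then show ?thesis using r unfolding s_def case_prod_beta by (intro continuous_intros) auto
    qed
    define T where "T = {t \<in> {0..1}. \<forall>u\<in>{0..1}. s (t, u) \<in> f ` ball 0 r}"
    \<comment> \<open>Both descriptions of T are used: the compact image of the closed disc gives
      closedness, the open image of the open disc gives openness.\<close>
    have T_alt: "T = {t \<in> {0..1}. \<forall>u\<in>{0..1}. s (t, u) \<in> f ` cball 0 r}"
    proof -
      have "s (t, u) \<in> f ` ball 0 r"
        if "t \<in> {0..1}" "\<And>u. u \<in> {0..1} \<Longrightarrow> s (t, u) \<in> f ` cball 0 r" "u \<in> {0..1}" for t u
        using segment_stays_inside[OF holf inj convex \<open>r < 1\<close> scaled[OF r(2) that(1)] scaled[OF r(3) that(1)] _ that(3)]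
          that(2) by (simp add: s_def)
      moreover have "f ` ball 0 r \<subseteq> f ` cball 0 r" by auto
      ultimately show ?thesis unfolding T_def by blast
    qed
    have "closedin (top_of_set {0..1}) T"
    proof -
      have clf: "closed (f ` cball 0 r)"
        using compact_continuous_image[OF continuous_on_subset[OF holomorphic_on_imp_continuous_on[OF holf] sub(1)]]
        by (simp add: compact_imp_closed)
      have "closedin (top_of_set {0..1}) {t \<in> {0..1}. s (t, u) \<in> f ` cball 0 r}" if "u \<in> {0..1}" for u
      proof -
        have "continuous_on {0..1} (\<lambda>t. s (t, u))"
          by (rule continuous_on_compose2[OF conts]) (use that in \<open>auto intro!: continuous_intros\<close>)
        then show ?thesis
          using continuous_closedin_preimage[OF _ clf, of "{0..1}" "\<lambda>t. s (t, u)"]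
          by (simp add: vimage_def Int_def conj_commute)
      qed
      then have "closedin (top_of_set {0..1}) (\<Inter>u\<in>{0..1}. {t \<in> {0..1}. s (t, u) \<in> f ` cball 0 r})"
        by (intro closedin_INT) auto
      also have "(\<Inter>u\<in>{0..1}. {t \<in> {0..1}. s (t, u) \<in> f ` cball 0 r}) = T"
      proof -
        have "(0::real) \<in> {0..1}" by simp
        then show ?thesis unfolding T_alt by blast
      qed
      finally show ?thesis .
    qed
    \<comment> \<open>The complement of T is the projection of a compact set of pairs (t, u), hence
      closed.\<close>
    moreover have "openin (top_of_set {0..1}) T"
    proof -
      have opf: "open (f ` ball 0 r)"
        by (rule open_mapping_thm3) (use sub holf inj in \<open>auto intro: holomorphic_on_subset inj_on_subset\<close>)
      have "closed (({0..1} \<times> {0..1}) \<inter> s -` (- f ` ball 0 r))"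
        by (rule continuous_closed_preimage[OF conts]) (use opf in \<open>auto intro: closed_Times\<close>)
      moreover have "bounded (({0..1::real} \<times> {0..1::real}) \<inter> s -` (- f ` ball 0 r))"
        by (rule bounded_subset[of "{0..1} \<times> {0..1}"]) (auto intro: bounded_Times)
      ultimately have "compact (({0..1} \<times> {0..1}) \<inter> s -` (- f ` ball 0 r))"
        by (simp add: compact_eq_bounded_closed)
      then have "compact (fst ` (({0..1} \<times> {0..1}) \<inter> s -` (- f ` ball 0 r)))"
        by (intro compact_continuous_image continuous_intros)
      then have cl: "closed (fst ` (({0..1} \<times> {0..1}) \<inter> s -` (- f ` ball 0 r)))"
        by (rule compact_imp_closed)
      have "T = {0..1} - fst ` (({0..1} \<times> {0..1}) \<inter> s -` (- f ` ball 0 r))"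
      proof -
        have fst_iff: "t \<in> fst ` ((I \<times> I) \<inter> s -` (- D)) \<longleftrightarrow> t \<in> I \<and> (\<exists>u\<in>I. s (t, u) \<notin> D)"
          for t D and I :: "real set" by (auto simp: image_iff Bex_def)
        show ?thesis by (rule set_eqI) (simp only: T_def Diff_iff mem_Collect_eq fst_iff, blast)
      qed
      then show ?thesis
        using openin_open_Int[OF open_Compl[OF cl], of "{0..1}"] by (simp only: Diff_eq)
    qed
    moreover have "0 \<in> T"
      using r by (auto simp: T_def s_def)
    moreover have "connected {0..1::real}" by simp
    ultimately have "T = {0..1}" unfolding connected_clopen by blast
    then have "1 \<in> T" by simp
    then have "s (1, u) \<in> f ` ball 0 r" using u by (simp add: T_def)
    then show ?thesis using sub(2) by (auto simp: s_def)
  qed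
  then show ?thesis unfolding convex_alt
    by (auto simp: scaleR_conv_of_real algebra_simps)
qed

section \<open>Tangent direction along the image of a circular arc\<close>

lemma circle_has_vector_derivative:
  fixes \<zeta> :: complex and r t :: real
  shows "((\<lambda>t. \<zeta> + of_real r * cis t) has_vector_derivative of_real r * (\<i> * cis t)) (at t within S)"
proof -
  have "(cis has_vector_derivative \<i> * cis t) (at t within S)"
    using has_derivative_cis[OF has_derivative_ident[of "at t within S"]]
    by (simp add: has_vector_derivative_def)
  then show ?thesis
    by (auto intro!: derivative_eq_intros)
qed

text \<open>Im M is a continuous argument of f' on the whole disc; it supplies the branch of the
  tangent argument that \<open>convex_arc\<close> asks for.\<close>

lemma obtain_log_deriv:
  fixes f :: "complex \<Rightarrow> complex"
  assumes "f holomorphic_on ball 0 1" and nz: "\<And>z. z \<in> ball 0 1 \<Longrightarrow> deriv f z \<noteq> 0"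
  obtains M where "\<And>z. z \<in> ball 0 1 \<Longrightarrow> deriv f z = exp (M z)"
    "\<And>z. z \<in> ball 0 1 \<Longrightarrow> (M has_field_derivative deriv (deriv f) z / deriv f z) (at z)"
proof -
  have hol: "deriv f holomorphic_on ball 0 1" by (intro holomorphic_deriv assms(1)) auto
  obtain M where M: "M holomorphic_on ball 0 1" "\<And>z. z \<in> ball 0 1 \<Longrightarrow> deriv f z = exp (M z)"
    using contractible_imp_holomorphic_log[OF hol _ nz] by (metis convex_ball convex_imp_contractible)
  have "(M has_field_derivative deriv (deriv f) z / deriv f z) (at z)" if z: "z \<in> ball 0 1" for z
  proof -
    have Mz: "(M has_field_derivative deriv M z) (at z)"
      using M(1) z by (intro holomorphic_derivI[of _ "ball 0 1"]) auto
    have "((\<lambda>z. exp (M z)) has_field_derivative deriv (deriv f) z) (at z)"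
      by (rule has_field_derivative_transform_within_open[OF holomorphic_derivI[OF hol open_ball z] open_ball z])
         (use M(2) in auto)
    moreover have "((\<lambda>z. exp (M z)) has_field_derivative exp (M z) * deriv M z) (at z)"
      by (rule DERIV_chain2[OF DERIV_exp Mz])
    ultimately have "deriv (deriv f) z = exp (M z) * deriv M z" by (rule DERIV_unique)
    then have "deriv M z = deriv (deriv f) z / deriv f z" using M(2)[OF z] by simp
    with Mz show ?thesis by simp
  qed
  with M(2) show ?thesis by (rule that)
qed

context
  fixes f M :: "complex \<Rightarrow> complex" and \<zeta> :: complex and r :: real
  assumes holf: "f holomorphic_on ball 0 1"
    and M: "\<And>z. z \<in> ball 0 1 \<Longrightarrow> deriv f z = exp (M z)"
    and M': "\<And>z. z \<in> ball 0 1 \<Longrightarrow> (M has_field_derivative deriv (deriv f) z / deriv f z) (at z)"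
    and r: "r > 0"
begin

text \<open>The image arc has tangent r \<i> e^(\<i>t) f'. The summands are the arguments of the
  factors: Im M for f', t for the rotating radius, pi/2 for \<i>.\<close>

definition tangent_angle :: "real \<Rightarrow> real" where
  "tangent_angle t = Im (M (\<zeta> + of_real r * cis t)) + t + pi / 2"

lemma arc_has_vector_derivative:
  assumes "\<zeta> + of_real r * cis t \<in> ball 0 1"
  shows "((\<lambda>t. f (\<zeta> + of_real r * cis t)) has_vector_derivative
     of_real r * (\<i> * cis t) * deriv f (\<zeta> + of_real r * cis t)) (at t)"
  using field_vector_diff_chain_at[OF circle_has_vector_derivative holomorphic_derivI[OF holf open_ball assms]]
  by (simp add: o_def)

lemma arc_tangent_polar:
  assumes "\<zeta> + of_real r * cis t \<in> ball 0 1"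
  shows "of_real r * (\<i> * cis t) * deriv f (\<zeta> + of_real r * cis t)
    = of_real (r * exp (Re (M (\<zeta> + of_real r * cis t)))) * cis (tangent_angle t)"
  using M[OF assms]
  by (simp add: tangent_angle_def exp_eq_polar cis_mult[symmetric] exp_of_real mult_ac del: cis_mult)

lemma tangent_angle_has_derivative:
  assumes "\<zeta> + of_real r * cis t \<in> ball 0 1"
  shows "(tangent_angle has_real_derivative
     Re (1 + of_real r * cis t * (deriv (deriv f) (\<zeta> + of_real r * cis t) / deriv f (\<zeta> + of_real r * cis t)))) (at t)"
proof -
  define q where "q = deriv (deriv f) (\<zeta> + of_real r * cis t) / deriv f (\<zeta> + of_real r * cis t)"
  have "((\<lambda>t. M (\<zeta> + of_real r * cis t)) has_vector_derivative of_real r * (\<i> * cis t) * q) (at t)"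
    using field_vector_diff_chain_at[OF circle_has_vector_derivative M'[OF assms]]
    by (simp add: o_def q_def)
  from bounded_linear.has_vector_derivative[OF bounded_linear_Im this]
  have "((\<lambda>t. Im (M (\<zeta> + of_real r * cis t))) has_real_derivative Im (of_real r * (\<i> * cis t) * q)) (at t)"
    unfolding has_real_derivative_iff_has_vector_derivative .
  then have "(tangent_angle has_real_derivative Im (of_real r * (\<i> * cis t) * q) + 1 + 0) (at t)"
    unfolding tangent_angle_def[abs_def] by (intro DERIV_add DERIV_const DERIV_ident)
  moreover have "Im (of_real r * (\<i> * cis t) * q) + 1 + 0 = Re (1 + of_real r * cis t * q)"
    by (simp add: algebra_simps)
  ultimately show ?thesis unfolding q_def by metis
qed

lemma convex_arcI:
  assumes in_ball: "\<And>t. t \<in> {a..b} \<Longrightarrow> \<zeta> + of_real r * cis t \<in> ball 0 1"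
    and nonneg: "\<And>t. t \<in> {a..b} \<Longrightarrow> Re (1 + of_real r * cis t *
       (deriv (deriv f) (\<zeta> + of_real r * cis t) / deriv f (\<zeta> + of_real r * cis t))) \<ge> 0"
  shows "convex_arc (\<lambda>t. f (\<zeta> + of_real r * cis t)) a b"
  unfolding convex_arc_def
proof (intro exI[of _ "\<lambda>t. of_real r * (\<i> * cis t) * deriv f (\<zeta> + of_real r * cis t)"]
    exI[of _ tangent_angle] conjI ballI)
  fix t assume t: "t \<in> {a..b}"
  show "((\<lambda>t. f (\<zeta> + of_real r * cis t)) has_vector_derivative
     of_real r * (\<i> * cis t) * deriv f (\<zeta> + of_real r * cis t)) (at t within {a..b})"
    using arc_has_vector_derivative[OF in_ball[OF t]] by (rule has_vector_derivative_at_within)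
  show "of_real r * (\<i> * cis t) * deriv f (\<zeta> + of_real r * cis t) \<noteq> 0"
    using M[OF in_ball[OF t]] r by simp
  show "of_real r * (\<i> * cis t) * deriv f (\<zeta> + of_real r * cis t)
     = of_real (norm (of_real r * (\<i> * cis t) * deriv f (\<zeta> + of_real r * cis t))) * cis (tangent_angle t)"
    unfolding arc_tangent_polar[OF in_ball[OF t]] using r by (simp add: norm_mult)
next
  have "isCont tangent_angle t" if "t \<in> {a..b}" for t
    using tangent_angle_has_derivative[OF in_ball[OF that]] by (rule DERIV_isCont)
  then show "continuous_on {a..b} tangent_angle"
    by (intro continuous_at_imp_continuous_on) auto
  show "mono_on {a..b} tangent_angle"
  proof (rule mono_onI)
    fix s t assume st: "s \<in> {a..b}" "t \<in> {a..b}" "s \<le> t"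
    have "\<exists>y. (tangent_angle has_real_derivative y) (at x) \<and> y \<ge> 0" if "s \<le> x" "x \<le> t" for x
      using tangent_angle_has_derivative[OF in_ball[of x]] nonneg[of x] st that
      by (meson atLeastAtMost_iff order_trans)
    then show "tangent_angle s \<le> tangent_angle t"
      by (intro DERIV_nonneg_imp_nondecreasing[OF st(3)])
  qed
qed

text \<open>The \<open>\<theta>\<close> of a convex arc may be another branch of the tangent
  argument, but its difference \<open>g\<close> from \<open>tangent_angle\<close> is continuous with
  values in 2 pi Z, hence constant near t0. A negative derivative of \<open>tangent_angle\<close> at
  t0 would then make \<open>\<theta>\<close> decrease just to the right of t0.\<close>

lemma convex_arcD:
  assumes "a < b" "t0 \<in> {a<..<b}"
    and in_ball: "\<And>t. t \<in> {a..b} \<Longrightarrow> \<zeta> + of_real r * cis t \<in> ball 0 1"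
    and "convex_arc (\<lambda>t. f (\<zeta> + of_real r * cis t)) a b"
  shows "Re (1 + of_real r * cis t0 *
       (deriv (deriv f) (\<zeta> + of_real r * cis t0) / deriv f (\<zeta> + of_real r * cis t0))) \<ge> 0"
proof (rule ccontr)
  assume "\<not> ?thesis"
  then obtain d where d: "d > 0" "\<And>h. 0 < h \<Longrightarrow> h < d \<Longrightarrow> tangent_angle (t0 + h) < tangent_angle t0"
    using DERIV_neg_dec_right[OF tangent_angle_has_derivative[OF in_ball[of t0]]] assms(2) by auto
  obtain w' \<theta> where w': "\<And>t. t \<in> {a..b} \<Longrightarrow>
       ((\<lambda>t. f (\<zeta> + of_real r * cis t)) has_vector_derivative w' t) (at t within {a..b})"
    and nz: "\<And>t. t \<in> {a..b} \<Longrightarrow> w' t \<noteq> 0"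
    and polar: "\<And>t. t \<in> {a..b} \<Longrightarrow> w' t = of_real (norm (w' t)) * cis (\<theta> t)"
    and cont: "continuous_on {a..b} \<theta>" and mono: "mono_on {a..b} \<theta>"
    using assms(4) unfolding convex_arc_def by blast
  define g where "g t = \<theta> t - tangent_angle t" for t
  have cis_g: "cis (g t) = 1" if t: "t \<in> {a..b}" for t
  proof -
    have "w' t = of_real r * (\<i> * cis t) * deriv f (\<zeta> + of_real r * cis t)"
      using vector_derivative_unique_within_closed_interval[OF \<open>a < b\<close>, of t "\<lambda>t. f (\<zeta> + of_real r * cis t)"] t w'[OF t]
        has_vector_derivative_at_within[OF arc_has_vector_derivative[OF in_ball[OF t]]]
      by simp
    also have "\<dots> = of_real (r * exp (Re (M (\<zeta> + of_real r * cis t)))) * cis (tangent_angle t)"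
      by (rule arc_tangent_polar[OF in_ball[OF t]])
    finally have w't: "w' t = of_real (r * exp (Re (M (\<zeta> + of_real r * cis t)))) * cis (tangent_angle t)" .
    then have "norm (w' t) = r * exp (Re (M (\<zeta> + of_real r * cis t)))"
      using r by (simp add: norm_mult)
    then have "of_real (norm (w' t)) * cis (\<theta> t) = of_real (norm (w' t)) * cis (tangent_angle t)"
      using w't polar[OF t] by metis
    then have "cis (\<theta> t) = cis (tangent_angle t)" using nz[OF t] by simp
    then show ?thesis by (simp add: g_def flip: cis_divide)
  qed
  have "isCont tangent_angle t" if "t \<in> {a..b}" for t
    using tangent_angle_has_derivative[OF in_ball[OF that]] by (rule DERIV_isCont)
  then have contg: "continuous_on {a..b} g"
    unfolding g_def[abs_def] by (intro continuous_intros cont continuous_at_imp_continuous_on) auto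
  obtain e where e: "e > 0" "\<And>t. t \<in> {a..b} \<Longrightarrow> dist t t0 < e \<Longrightarrow> dist (g t) (g t0) < 2 * pi"
    using contg[unfolded continuous_on_iff, rule_format, of t0 "2 * pi"] assms(2) pi_gt_zero by auto
  define h where "h = min d (min e (b - t0)) / 2"
  have h: "0 < h" "h < d" "h < e" "t0 + h \<in> {a..b}" "t0 \<in> {a..b}"
    using d e assms(2) by (auto simp: h_def min_def divide_simps)
  have "g (t0 + h) = g t0"
  proof -
    have "cis (g (t0 + h) - g t0) = 1"
      using cis_g[OF h(4)] cis_g[OF h(5)] by (simp flip: cis_divide)
    then have "exp (\<i> * of_real (g (t0 + h) - g t0)) = 1"
      by (simp only: cis_conv_exp)
    then obtain n :: int where n: "g (t0 + h) - g t0 = of_int (2 * n) * pi"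
      unfolding exp_eq_1 by auto
    moreover have "\<bar>g (t0 + h) - g t0\<bar> < 2 * pi"
      using e(2)[OF h(4)] h by (simp add: dist_real_def)
    ultimately have "\<bar>of_int n\<bar> * (2 * pi) < 1 * (2 * pi)" by (simp add: abs_mult)
    then have "\<bar>of_int n :: real\<bar> < 1" by (subst (asm) mult_less_cancel_right_pos) auto
    then have "n = 0" by linarith
    with n show ?thesis by simp
  qed
  moreover have "\<theta> t0 \<le> \<theta> (t0 + h)"
    using mono h by (auto intro: mono_onD)
  moreover have "tangent_angle (t0 + h) < tangent_angle t0" by (rule d(2)) (use h in auto)
  ultimately show False by (simp add: g_def)
qed

end

section \<open>From f''/f' to uniform convexity and back\<close>

text \<open>On an arc about \<zeta> the angle of the tangent has derivative Re (1 + (z - \<zeta>)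
  f''/f'), which is positive as |z - \<zeta>| < 2. Univalence comes from the same bound: log f'
  differs from its value at 0 by at most 1/2 < pi/2, so Re f' > 0, and a function with this property
  is injective on a convex set.\<close>

lemma uniformly_convexI:
  assumes holf: "f holomorphic_on ball 0 1" and "f 0 = 0" and f'0: "deriv f 0 = 1"
    and nz: "\<And>z. z \<in> ball 0 1 \<Longrightarrow> deriv f z \<noteq> 0"
    and q: "\<And>z. z \<in> ball 0 1 \<Longrightarrow> norm (deriv (deriv f) z / deriv f z) \<le> 1 / 2"
  shows "uniformly_convex f"
proof -
  obtain M where M: "\<And>z. z \<in> ball 0 1 \<Longrightarrow> deriv f z = exp (M z)"
    and M': "\<And>z. z \<in> ball 0 1 \<Longrightarrow> (M has_field_derivative deriv (deriv f) z / deriv f z) (at z)"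
    using obtain_log_deriv[OF holf nz] by blast
  have nonneg: "Re (1 + x * (deriv (deriv f) z / deriv f z)) > 0" if "norm x < 2" "z \<in> ball 0 1" for x z
  proof -
    have "norm (x * (deriv (deriv f) z / deriv f z)) \<le> norm x * (1 / 2)"
      unfolding norm_mult by (rule mult_left_mono[OF q[OF that(2)]]) simp
    also have "\<dots> < 1" using that by simp
    finally show ?thesis
      using abs_Re_le_cmod[of "x * (deriv (deriv f) z / deriv f z)"] by simp
  qed
  have Re_pos: "Re (deriv f z) > 0" if z: "z \<in> ball 0 1" for z
  proof -
    have "norm (M z - M 0) \<le> 1 / 2 * norm (z - 0)"
      by (rule field_differentiable_bound[OF convex_ball[of 0 1] has_field_derivative_at_within[OF M'] q]) (use z in auto)
    then have "\<bar>Im (M z - M 0)\<bar> \<le> 1 / 2"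
      using abs_Im_le_cmod[of "M z - M 0"] z by simp
    then have "cos (Im (M z - M 0)) > 0"
      using pi_gt3 by (intro cos_gt_zero_pi) linarith+
    moreover have "deriv f z = exp (M z - M 0)"
      using M[OF z] M[of 0] f'0 by (simp add: exp_diff)
    ultimately show ?thesis by (simp add: Re_exp)
  qed
  have inj: "inj_on f (ball 0 1)"
  proof (rule inj_onI, rule ccontr)
    fix x y assume xy: "x \<in> ball 0 1" "y \<in> ball 0 1" "f x = f y" "x \<noteq> y"
    have sub: "closed_segment x y \<subseteq> ball 0 1" using xy by (intro closed_segment_subset) auto
    \<comment> \<open>The mean value theorem along a segment concerns real parts. Dividing f by y -
      x beforehand turns the increment into Re f'(u).\<close>
    have "\<exists>u. u \<in> closed_segment x y \<and> Re (f y / (y - x)) - Re (f x / (y - x)) = Re (deriv f u / (y - x) * (y - x))"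
      by (rule complex_mvt_line, rule DERIV_cdivide, rule holomorphic_derivI[OF holf]) (use sub in auto)
    then obtain u where "u \<in> closed_segment x y" "Re (deriv f u) = 0" using xy by auto
    then show False using sub Re_pos[of u] by auto
  qed
  have "convex_arc (\<lambda>t. f (\<zeta> + of_real r * cis t)) a b"
    if z: "\<zeta> \<in> ball 0 1" "r > 0" and in_ball: "\<forall>t\<in>{a..b}. \<zeta> + of_real r * cis t \<in> ball 0 1" for \<zeta> r a b
  proof (rule convex_arcI[OF holf M M' \<open>r > 0\<close>])
    fix t assume t: "t \<in> {a..b}"
    show "\<zeta> + of_real r * cis t \<in> ball 0 1" using in_ball t by blast
    have "norm (of_real r * cis t) \<le> norm (\<zeta> + of_real r * cis t) + norm \<zeta>"
      using norm_triangle_ineq4[of "\<zeta> + of_real r * cis t" \<zeta>] by simp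
    also have "\<dots> < 2" using in_ball t z by fastforce
    finally show "Re (1 + of_real r * cis t * (deriv (deriv f) (\<zeta> + of_real r * cis t) / deriv f (\<zeta> + of_real r * cis t))) \<ge> 0"
      using in_ball t by (intro less_imp_le[OF nonneg]) auto
  qed auto
  \<comment> \<open>This is the case of radius vector x = z, that is, \<zeta> = 0.\<close>
  moreover have "convex (f ` ball 0 1)"
    by (rule convex_image_ball[OF holf inj]) (use nonneg in \<open>force simp flip: times_divide_eq_right\<close>)
  ultimately show ?thesis
    unfolding uniformly_convex_def using assms inj by blast
qed

lemma uniformly_convexD:
  assumes uc: "uniformly_convex f" and z: "z \<in> ball 0 1" "z \<noteq> 0"
  shows "Re (z * (deriv (deriv f) z / deriv f z)) \<ge> - 1 / 2"
proof -
  have holf: "f holomorphic_on ball 0 1" and inj: "inj_on f (ball 0 1)"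
    using uc by (auto simp: uniformly_convex_def)
  have arcs: "convex_arc (\<lambda>t. f (\<zeta> + of_real r * cis t)) a b"
    if "\<zeta> \<in> ball 0 1" "r > 0" "a < b" "b \<le> a + 2 * pi"
      "\<And>t. t \<in> {a..b} \<Longrightarrow> \<zeta> + of_real r * cis t \<in> ball 0 1" for \<zeta> r a b
    using uc that unfolding uniformly_convex_def by blast
  obtain M where M: "\<And>z. z \<in> ball 0 1 \<Longrightarrow> deriv f z = exp (M z)"
    and M': "\<And>z. z \<in> ball 0 1 \<Longrightarrow> (M has_field_derivative deriv (deriv f) z / deriv f z) (at z)"
    using obtain_log_deriv[OF holf] holomorphic_injective_imp_regular[OF holf open_ball inj] by blast
  define r t0 where "r = 2 * norm z" and "t0 = Arg z"
  have r: "r > 0" using z by (simp add: r_def)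
  have t0: "of_real r * cis t0 = 2 * z"
    using z by (simp add: r_def t0_def cis_Arg complex_sgn_def scaleR_conv_of_real)
  have "isCont (\<lambda>t. - z + of_real r * cis t) t0"
    using circle_has_vector_derivative[of "- z" r t0 UNIV] has_vector_derivative_continuous by blast
  moreover have "- z + of_real r * cis t0 \<in> ball 0 1" using z by (simp add: t0)
  ultimately have "eventually (\<lambda>t. - z + of_real r * cis t \<in> ball 0 1) (nhds t0)"
    using topological_tendstoD[of "\<lambda>t. - z + of_real r * cis t" _ "at t0" "ball 0 1"]
    by (auto simp: isCont_def eventually_nhds_conv_at)
  then obtain e where e: "e > 0" "\<And>t. dist t t0 < e \<Longrightarrow> - z + of_real r * cis t \<in> ball 0 1"
    unfolding eventually_nhds_metric by blast
  \<comment> \<open>e / 2 keeps the arc in the disc, pi keeps its angular length within a full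
    turn.\<close>
  define d where "d = min (e / 2) pi"
  have d: "d > 0" "d < e" "d \<le> pi" using e by (auto simp: d_def)
  have in_ball: "- z + of_real r * cis t \<in> ball 0 1" if "t \<in> {t0 - d..t0 + d}" for t
    using that d by (intro e) (auto simp: dist_real_def)
  have "convex_arc (\<lambda>t. f (- z + of_real r * cis t)) (t0 - d) (t0 + d)"
    by (rule arcs) (use in_ball z r d in auto)
  then have "Re (1 + of_real r * cis t0 *
       (deriv (deriv f) (- z + of_real r * cis t0) / deriv f (- z + of_real r * cis t0))) \<ge> 0"
    using d in_ball by (intro convex_arcD[OF holf M M' r, of "t0 - d" "t0 + d"]) auto
  moreover have Re_half: "Re x \<ge> - 1 / 2" if "Re (1 + 2 * x) \<ge> 0" for x using that by simp
  ultimately have "Re (1 + 2 * (z * (deriv (deriv f) z / deriv f z))) \<ge> 0"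
    by (simp add: t0 mult.assoc)
  then show ?thesis using Re_half by blast
qed

section \<open>Power series of Bessel functions and the Riccati equation\<close>

text \<open>Taylor coefficients of the hypergeometric function 0F1(; \<nu>+1; -s/4), which is the
  factor Phi.\<close>

definition bessel_coeff :: "real \<Rightarrow> nat \<Rightarrow> real" where
  "bessel_coeff \<nu> n = (-1/4) ^ n / (fact n * pochhammer (\<nu> + 1) n)"

definition bessel_fps :: "real \<Rightarrow> complex fps" where
  "bessel_fps \<nu> = Abs_fps (\<lambda>n. of_real (bessel_coeff \<nu> n))"

lemma bessel_coeff_0 [simp]: "bessel_coeff \<nu> 0 = 1"
  by (simp add: bessel_coeff_def)

lemma bessel_coeff_rec:
  assumes "\<nu> > -1"
  shows "(n + 1) * (n + \<nu> + 1) * bessel_coeff \<nu> (Suc n) = - bessel_coeff \<nu> n / 4"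
proof -
  have "pochhammer (\<nu> + 1) n > 0" using assms by (intro pochhammer_pos) auto
  moreover have "\<nu> + 1 + real n \<noteq> 0" using assms by linarith
  ultimately show ?thesis
    unfolding bessel_coeff_def pochhammer_Suc fact_Suc
    by (simp add: divide_simps add_ac)
qed

lemma pochhammer_ge:
  fixes x :: real
  assumes "x > 0"
  shows "pochhammer x (Suc n) \<ge> x"
proof (induction n)
  case (Suc n)
  have "x * 1 \<le> pochhammer x (Suc n) * (x + real (Suc n))"
    using assms Suc by (intro mult_mono) auto
  then show ?case by (simp only: pochhammer_Suc[of x "Suc n"])
qed simp

text \<open>For \<nu> > -1 the first factor \<nu> + 1 of the Pochhammer symbol may be arbitrarily
  small, while the others exceed 1. Multiplying by it gives a bound uniform in \<nu>, fit also for
  orders near -1.\<close>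

lemma bessel_coeff_bound:
  assumes "\<nu> > -1" "n > 0"
  shows "(\<nu> + 1) * \<bar>bessel_coeff \<nu> n\<bar> \<le> (1/4) ^ n / fact n"
proof -
  obtain m where m: "n = Suc m" using assms(2) gr0_implies_Suc by blast
  have ge: "pochhammer (\<nu> + 1) n \<ge> \<nu> + 1"
    using pochhammer_ge[of "\<nu> + 1" m] assms m by auto
  have pos: "pochhammer (\<nu> + 1) n > 0" using ge assms by linarith
  have "(\<nu> + 1) * \<bar>bessel_coeff \<nu> n\<bar> = (1/4) ^ n / fact n * ((\<nu> + 1) / pochhammer (\<nu> + 1) n)"
    using pos by (simp add: bessel_coeff_def abs_mult power_abs)
  also have "\<dots> \<le> (1/4) ^ n / fact n * 1"
    using ge pos assms by (intro mult_left_mono) (auto simp: divide_simps)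
  finally show ?thesis by simp
qed

lemma fps_conv_radius_bessel:
  assumes "\<nu> > -1"
  shows "fps_conv_radius (bessel_fps \<nu>) = \<infinity>"
  unfolding fps_conv_radius_def
proof (rule conv_radius_inftyI'')
  fix z :: complex
  have s: "summable (\<lambda>n. 1 / (\<nu> + 1) * ((norm z / 4) ^ n / fact n))"
    using summable_exp_generic[of "norm z / 4"]
    by (intro summable_mult) (simp add: field_simps)
  have "norm (fps_nth (bessel_fps \<nu>) n * z ^ n) \<le> 1 / (\<nu> + 1) * ((norm z / 4) ^ n / fact n)"
    if "n \<ge> 1" for n
  proof -
    have "\<bar>bessel_coeff \<nu> n\<bar> \<le> 1 / (\<nu> + 1) * ((1/4) ^ n / fact n)"
      using bessel_coeff_bound[of \<nu> n] that assms by (simp add: pos_le_divide_eq mult_ac)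
    then have "\<bar>bessel_coeff \<nu> n\<bar> * norm z ^ n \<le> 1 / (\<nu> + 1) * ((1/4) ^ n / fact n) * norm z ^ n"
      by (intro mult_right_mono) auto
    then show ?thesis
      by (simp add: bessel_fps_def norm_mult norm_power power_divide)
  qed
  then show "summable (\<lambda>n. fps_nth (bessel_fps \<nu>) n * z ^ n)"
    by (intro summable_comparison_test[OF _ s]) blast
qed

lemma bessel_fps_ode:
  assumes "\<nu> > -1"
  shows "fps_X * fps_deriv (fps_deriv (bessel_fps \<nu>))
      + fps_const (of_real (\<nu> + 1)) * fps_deriv (bessel_fps \<nu>)
      = fps_const (- 1 / 4) * bessel_fps \<nu>"
proof (rule fps_ext)
  fix n
  have "complex_of_real ((n + 1) * (n + \<nu> + 1) * bessel_coeff \<nu> (Suc n))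
      = complex_of_real (- bessel_coeff \<nu> n / 4)"
    by (simp only: bessel_coeff_rec[OF assms])
  then show "fps_nth (fps_X * fps_deriv (fps_deriv (bessel_fps \<nu>))
      + fps_const (of_real (\<nu> + 1)) * fps_deriv (bessel_fps \<nu>)) n
      = fps_nth (fps_const (- 1 / 4) * bessel_fps \<nu>) n"
    by (cases n) (simp_all add: bessel_fps_def algebra_simps)
qed

text \<open>\<open>rayleigh \<nu> k\<close> is twice the Rayleigh sum \<open>\<Sum>\<^sub>n j\<^sub>n\<^bsup>-2k\<^esup>\<close> over the positive zeros of the Bessel function of
  order \<open>\<nu>\<close>; the recursion is the Riccati equation read off coefficientwise.\<close>

fun rayleigh :: "real \<Rightarrow> nat \<Rightarrow> real" where
  "rayleigh \<nu> 0 = 0"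
| "rayleigh \<nu> (Suc n) = (of_bool (n = 0) + (\<Sum>i\<in>{1..n}. rayleigh \<nu> i * rayleigh \<nu> (Suc n - i)))
     / (2 * real (Suc n) + 2 * \<nu>)"

lemma rayleigh_unfold:
  "rayleigh \<nu> n = (of_bool (n = 1) + (\<Sum>i\<in>{1..<n}. rayleigh \<nu> i * rayleigh \<nu> (n - i))) / (2 * n + 2 * \<nu>)"
  by (cases n) (simp_all add: atLeastLessThanSuc_atLeastAtMost del: of_nat_Suc)

declare rayleigh.simps(2) [simp del]

lemma rayleigh_1: "rayleigh \<nu> (Suc 0) = 1 / (2 * (\<nu> + 1))"
  by (simp add: rayleigh_unfold[of _ "Suc 0"])

lemma rayleigh_nonneg:
  assumes "\<nu> > 0"
  shows "rayleigh \<nu> n \<ge> 0"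
proof (induction n rule: less_induct)
  case (less n)
  then show ?case using assms
    by (subst rayleigh_unfold) (auto intro!: divide_nonneg_nonneg add_nonneg_nonneg sum_nonneg mult_nonneg_nonneg)
qed

lemma rayleigh_antimono:
  assumes "0 < \<nu>" "\<nu> \<le> \<mu>"
  shows "rayleigh \<mu> n \<le> rayleigh \<nu> n"
proof (induction n rule: less_induct)
  case (less n)
  show ?case
  proof (cases "n = 0")
    case False
    have "(\<Sum>i\<in>{1..<n}. rayleigh \<mu> i * rayleigh \<mu> (n - i)) \<le> (\<Sum>i\<in>{1..<n}. rayleigh \<nu> i * rayleigh \<nu> (n - i))"
      using less assms by (intro sum_mono mult_mono) (auto intro: rayleigh_nonneg)
    moreover have "0 \<le> (\<Sum>i\<in>{1..<n}. rayleigh \<mu> i * rayleigh \<mu> (n - i))"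
      using assms by (intro sum_nonneg mult_nonneg_nonneg rayleigh_nonneg) auto
    ultimately show ?thesis
      using assms False by (subst (1 2) rayleigh_unfold) (intro frac_le, auto)
  qed simp
qed

text \<open>Ratio and constant are chosen to give equality at n = 1. The induction closes because
  the convolution consists of n - 1 equal products 4 r^n, and 4 (n - 1) \<le> 2 (2 n + 2
  \<nu>).\<close>

lemma rayleigh_le:
  assumes "\<nu> > 0"
  shows "rayleigh \<nu> n \<le> 2 * (1 / (4 * (\<nu> + 1))) ^ n"
proof (induction n rule: less_induct)
  case (less n)
  let ?r = "1 / (4 * (\<nu> + 1))"
  consider "n = 0" | "n = 1" | "n \<ge> 2" by linarith
  then show ?case
  proof cases
    case 3
    have "(\<Sum>i\<in>{1..<n}. rayleigh \<nu> i * rayleigh \<nu> (n - i)) \<le> (\<Sum>i\<in>{1..<n}. (2 * ?r ^ i) * (2 * ?r ^ (n - i)))"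
      using less assms by (intro sum_mono mult_mono) (auto intro: rayleigh_nonneg)
    also have "\<dots> = (\<Sum>i\<in>{1..<n}. 4 * ?r ^ n)"
      by (intro sum.cong refl) (auto simp flip: power_add simp: mult_ac)
    also have "\<dots> = real (n - 1) * (4 * ?r ^ n)"
      by simp
    also have "\<dots> \<le> (2 * ?r ^ n) * (2 * n + 2 * \<nu>)"
      using 3 assms by (simp add: of_nat_diff mult_right_mono algebra_simps)
    finally show ?thesis
      using 3 assms by (subst rayleigh_unfold) (simp add: divide_le_eq)
  qed (use assms in \<open>simp_all add: rayleigh_1 divide_simps\<close>)
qed

definition rayleigh_fps :: "real \<Rightarrow> complex fps" where
  "rayleigh_fps \<nu> = Abs_fps (\<lambda>n. of_real (rayleigh \<nu> n))"

lemma rayleigh_rec: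
  assumes "\<nu> > 0"
  shows "(2 * n + 2 * \<nu>) * rayleigh \<nu> n = of_bool (n = 1) + (\<Sum>i\<le>n. rayleigh \<nu> i * rayleigh \<nu> (n - i))"
proof -
  have "(\<Sum>i\<le>n. rayleigh \<nu> i * rayleigh \<nu> (n - i)) = (\<Sum>i\<in>{1..<n}. rayleigh \<nu> i * rayleigh \<nu> (n - i))"
  proof (rule sum.mono_neutral_right)
    show "\<forall>i\<in>{..n} - {1..<n}. rayleigh \<nu> i * rayleigh \<nu> (n - i) = 0"
    proof
      fix i assume "i \<in> {..n} - {1..<n}"
      then have "i = 0 \<or> i = n" by auto
      then show "rayleigh \<nu> i * rayleigh \<nu> (n - i) = 0" by auto
    qed
  qed auto
  moreover have "2 * real n + 2 * \<nu> \<noteq> 0" using assms by auto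
  ultimately show ?thesis by (subst (1) rayleigh_unfold) simp
qed

lemma rayleigh_fps_riccati:
  assumes "\<nu> > 0"
  shows "2 * fps_X * fps_deriv (rayleigh_fps \<nu>) + fps_const (of_real (2 * \<nu>)) * rayleigh_fps \<nu>
      = rayleigh_fps \<nu> ^ 2 + fps_X"
proof (rule fps_ext)
  fix n
  have "complex_of_real ((2 * n + 2 * \<nu>) * rayleigh \<nu> n)
     = of_real (of_bool (n = 1) + (\<Sum>i\<le>n. rayleigh \<nu> i * rayleigh \<nu> (n - i)))"
    by (simp only: rayleigh_rec[OF assms])
  moreover have "fps_nth (2 * fps_X * fps_deriv (rayleigh_fps \<nu>)) n = of_real (2 * n * rayleigh \<nu> n)"
    by (cases n) (simp_all add: rayleigh_fps_def mult.assoc numeral_fps_const)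
  moreover have "fps_nth (fps_const (of_real (2 * \<nu>)) * rayleigh_fps \<nu>) n = of_real (2 * \<nu> * rayleigh \<nu> n)"
    by (simp add: rayleigh_fps_def)
  moreover have "fps_nth (rayleigh_fps \<nu> ^ 2) n = of_real (\<Sum>i\<le>n. rayleigh \<nu> i * rayleigh \<nu> (n - i))"
    by (simp add: rayleigh_fps_def power2_eq_square fps_mult_nth atLeast0AtMost)
  ultimately show "fps_nth (2 * fps_X * fps_deriv (rayleigh_fps \<nu>) + fps_const (of_real (2 * \<nu>)) * rayleigh_fps \<nu>) n
      = fps_nth (rayleigh_fps \<nu> ^ 2 + fps_X) n"
    by (simp only: fps_add_nth) (auto simp: ring_distribs)
qed

text \<open>The defect \<open>Q = 2 X \<Phi>' + P \<Phi>\<close> solves the first-order linear equation \<open>2 X Q' = (P - 2 \<nu>) Q\<close>, whose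
  only formal solution is 0 because \<open>n + \<nu> \<noteq> 0\<close> for every exponent \<open>n\<close>.\<close>

lemma rayleigh_fps_bessel_fps:
  assumes "\<nu> > 0"
  shows "rayleigh_fps \<nu> * bessel_fps \<nu> = - 2 * fps_X * fps_deriv (bessel_fps \<nu>)"
proof -
  define B P where "B = bessel_fps \<nu>" and "P = rayleigh_fps \<nu>"
  define c where "c = fps_const (of_real \<nu> :: complex)"
  define Q where "Q = 2 * fps_X * fps_deriv B + P * B"
  have four: "4 * (fps_const (- 1 / 4) * B) = - B"
    by (simp add: numeral_fps_const flip: mult.assoc fps_const_neg)
  have one: "fps_X * fps_deriv (fps_deriv B) + (c + 1) * fps_deriv B = fps_const (- 1 / 4) * B"
    using bessel_fps_ode[of \<nu>] assms
    by (simp add: B_def c_def flip: fps_const_add)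
  have ode: "4 * (fps_X * fps_deriv (fps_deriv B)) = - B - 4 * (c + 1) * fps_deriv B"
    using arg_cong[OF one, of "\<lambda>x. 4 * x"] unfolding four by (simp add: algebra_simps)
  have two: "fps_const (of_real (2 * \<nu>)) = 2 * c"
    by (simp add: c_def numeral_fps_const)
  have ric: "2 * fps_X * fps_deriv P + 2 * c * P = P ^ 2 + fps_X"
    using rayleigh_fps_riccati[OF assms] unfolding two P_def by simp
  have "2 * fps_X * fps_deriv Q = 4 * fps_X * fps_deriv B + fps_X * (4 * (fps_X * fps_deriv (fps_deriv B)))
       + (2 * fps_X * fps_deriv P) * B + 2 * fps_X * P * fps_deriv B"
    by (simp add: Q_def algebra_simps)
  also have "2 * fps_X * fps_deriv P = P ^ 2 + fps_X - 2 * c * P"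
    using ric by (simp add: algebra_simps)
  finally have Q: "2 * fps_X * fps_deriv Q = (P - 2 * c) * Q"
    unfolding ode Q_def by (simp add: algebra_simps power2_eq_square)
  have "fps_nth Q n = 0" for n
  proof (induction n rule: less_induct)
    case (less n)
    \<comment> \<open>P has constant term 0, so this coefficient involves only coefficients of Q
      below n.\<close>
    have "fps_nth (P * Q) n = 0"
    proof -
      have "fps_nth P i * fps_nth Q (n - i) = 0" if "i \<le> n" for i
        using less[of "n - i"] that by (cases "i = 0") (auto simp: P_def rayleigh_fps_def)
      then show ?thesis by (auto simp: fps_mult_nth intro!: sum.neutral)
    qed
    moreover have "fps_nth (2 * fps_X * fps_deriv Q) n = of_nat (2 * n) * fps_nth Q n"
      by (cases n) (simp_all add: mult.assoc numeral_fps_const)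
    moreover have "fps_nth ((P - 2 * c) * Q) n = fps_nth (P * Q) n - of_real (2 * \<nu>) * fps_nth Q n"
    proof -
      have "(P - 2 * c) * Q = P * Q - fps_const (of_real (2 * \<nu>)) * Q"
        unfolding two by (simp add: left_diff_distrib)
      then show ?thesis by (simp only: fps_sub_nth fps_mult_left_const_nth)
    qed
    ultimately have "of_nat (2 * n) * fps_nth Q n = 0 - of_real (2 * \<nu>) * fps_nth Q n"
      unfolding Q by metis
    then have "of_real (2 * real n + 2 * \<nu>) * fps_nth Q n = 0"
      by (simp add: distrib_right mult.assoc)
    moreover have "2 * real n + 2 * \<nu> \<noteq> 0" using assms by auto
    ultimately show ?case by (metis mult_eq_0_iff of_real_eq_0_iff)
  qed
  then have "Q = 0" by (simp add: fps_eq_iff)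
  then show ?thesis by (simp add: Q_def B_def P_def add_eq_0_iff)
qed

lemma fps_conv_radius_rayleigh:
  assumes "\<nu> > 0"
  shows "fps_conv_radius (rayleigh_fps \<nu>) > 1"
proof -
  \<comment> \<open>The coefficients are at most 2 * 4^(-n). A radius beyond 1 makes P and P'
    available at the boundary point s = 1.\<close>
  have "conv_radius (\<lambda>n. complex_of_real (rayleigh \<nu> n)) \<ge> 2"
  proof (rule conv_radius_geI_ex)
    fix r :: real assume r: "0 < r" "ereal r < 2"
    have s: "summable (\<lambda>n. 2 * (1/2::real) ^ n)" by (intro summable_mult summable_geometric) simp
    have "norm (complex_of_real (rayleigh \<nu> n) * of_real r ^ n) \<le> 2 * (1/2) ^ n" for n
    proof -
      have "1 / (4 * (\<nu> + 1)) \<le> 1/4" using assms by (simp add: field_simps)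
      then have "(1 / (4 * (\<nu> + 1))) ^ n \<le> (1/4) ^ n" using assms by (intro power_mono) auto
      then have "rayleigh \<nu> n \<le> 2 * (1/4) ^ n" using rayleigh_le[OF assms, of n] by linarith
      moreover have "r ^ n \<le> 2 ^ n" using r by (intro power_mono) auto
      ultimately have "rayleigh \<nu> n * r ^ n \<le> (2 * (1/4) ^ n) * 2 ^ n"
        using r by (intro mult_mono) auto
      also have "\<dots> = 2 * (1/2) ^ n" using power_mult_distrib[of "1/4::real" 2 n] by simp
      finally show ?thesis using r rayleigh_nonneg[OF assms, of n] by (simp add: norm_mult norm_power)
    qed
    then show "\<exists>z. norm z = r \<and> summable (\<lambda>n. complex_of_real (rayleigh \<nu> n) * z ^ n)"
      using r by (intro exI[of _ "of_real r"] conjI summable_comparison_test[OF _ s]) auto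
  qed
  then show ?thesis unfolding fps_conv_radius_def rayleigh_fps_def
    by (simp add: less_le_trans[of 1 2])
qed

section \<open>The entire factor of the Bessel function\<close>

definition bessel_phi :: "real \<Rightarrow> complex \<Rightarrow> complex" where
  "bessel_phi \<nu> = eval_fps (bessel_fps \<nu>)"

definition bessel_phi' :: "real \<Rightarrow> complex \<Rightarrow> complex" where
  "bessel_phi' \<nu> = eval_fps (fps_deriv (bessel_fps \<nu>))"

lemma fps_conv_radius_bessel_deriv:
  assumes "\<nu> > -1"
  shows "fps_conv_radius (fps_deriv (bessel_fps \<nu>)) = \<infinity>"
  using fps_conv_radius_deriv[of "bessel_fps \<nu>"] fps_conv_radius_bessel[OF assms] by simp

lemma bessel_phi_sums:
  assumes "\<nu> > -1"
  shows "(\<lambda>n. of_real (bessel_coeff \<nu> n) * s ^ n) sums bessel_phi \<nu> s"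
  using sums_eval_fps[of s "bessel_fps \<nu>"] fps_conv_radius_bessel[OF assms]
  by (simp add: bessel_phi_def bessel_fps_def)

lemma bessel_phi'_sums:
  assumes "\<nu> > -1"
  shows "(\<lambda>n. of_real (real (Suc n) * bessel_coeff \<nu> (Suc n)) * s ^ n) sums bessel_phi' \<nu> s"
  using sums_eval_fps[of s "fps_deriv (bessel_fps \<nu>)"] fps_conv_radius_bessel_deriv[OF assms]
  by (simp add: bessel_phi'_def bessel_fps_def)

lemma bessel_phi_0 [simp]: "bessel_phi \<nu> 0 = 1"
  by (simp add: bessel_phi_def eval_fps_at_0 bessel_fps_def)

lemma bessel_phi_deriv:
  assumes "\<nu> > -1"
  shows "(bessel_phi \<nu> has_field_derivative bessel_phi' \<nu> s) (at s)"
  unfolding bessel_phi_def bessel_phi'_def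
  by (rule has_field_derivative_eval_fps) (simp add: fps_conv_radius_bessel[OF assms])

text \<open>Bessel's equation in the variable s. The second derivative of Phi enters later only
  through this relation, so it stays an anonymous d.\<close>

lemma bessel_phi'_deriv:
  assumes "\<nu> > -1"
  obtains d where "(bessel_phi' \<nu> has_field_derivative d) (at s)"
    "s * d + of_real (\<nu> + 1) * bessel_phi' \<nu> s = - bessel_phi \<nu> s / 4"
proof
  let ?d = "eval_fps (fps_deriv (fps_deriv (bessel_fps \<nu>))) s"
  show "(bessel_phi' \<nu> has_field_derivative ?d) (at s)"
    unfolding bessel_phi'_def
    by (rule has_field_derivative_eval_fps) (simp add: fps_conv_radius_bessel_deriv[OF assms])
  have r: "fps_conv_radius (fps_deriv (fps_deriv (bessel_fps \<nu>))) = \<infinity>"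
    using fps_conv_radius_deriv[of "fps_deriv (bessel_fps \<nu>)"] fps_conv_radius_bessel_deriv[OF assms] by simp
  have r1: "fps_conv_radius (fps_X * fps_deriv (fps_deriv (bessel_fps \<nu>))) = \<infinity>"
    using fps_conv_radius_mult[of fps_X "fps_deriv (fps_deriv (bessel_fps \<nu>))"] r by simp
  have r2: "fps_conv_radius (fps_const c * fps_deriv (bessel_fps \<nu>)) = \<infinity>" for c
    using fps_conv_radius_mult[of "fps_const c" "fps_deriv (bessel_fps \<nu>)"] fps_conv_radius_bessel_deriv[OF assms] by simp
  show "s * ?d + of_real (\<nu> + 1) * bessel_phi' \<nu> s = - bessel_phi \<nu> s / 4"
    using arg_cong[OF bessel_fps_ode[OF assms], of "\<lambda>F. eval_fps F s"]
    by (simp add: eval_fps_add eval_fps_mult r r1 r2 fps_conv_radius_bessel[OF assms]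
        fps_conv_radius_bessel_deriv[OF assms] bessel_phi_def bessel_phi'_def)
qed

lemma continuous_on_bessel_phi [continuous_intros]:
  assumes "\<nu> > -1" "continuous_on A g"
  shows "continuous_on A (\<lambda>x. bessel_phi \<nu> (g x))"
  by (rule continuous_on_compose2[OF _ assms(2), of UNIV])
     (auto intro!: continuous_at_imp_continuous_on DERIV_isCont[OF bessel_phi_deriv[OF assms(1)]])

lemma continuous_on_bessel_phi' [continuous_intros]:
  assumes "\<nu> > -1" "continuous_on A g"
  shows "continuous_on A (\<lambda>x. bessel_phi' \<nu> (g x))"
proof (rule continuous_on_compose2[OF _ assms(2), of UNIV])
  have "isCont (bessel_phi' \<nu>) s" for s
    using bessel_phi'_deriv[OF assms(1), of s] DERIV_isCont by blast
  then show "continuous_on UNIV (bessel_phi' \<nu>)"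
    by (auto intro!: continuous_at_imp_continuous_on)
qed auto

lemma holomorphic_on_bessel_phi [holomorphic_intros]:
  assumes "\<nu> > -1" "g holomorphic_on A"
  shows "(\<lambda>x. bessel_phi \<nu> (g x)) holomorphic_on A"
proof -
  have "bessel_phi \<nu> holomorphic_on UNIV"
    unfolding bessel_phi_def by (intro holomorphic_intros) (simp add: fps_conv_radius_bessel[OF assms(1)])
  from holomorphic_on_compose_gen[OF assms(2) this] show ?thesis by (simp add: o_def)
qed

lemma holomorphic_on_bessel_phi' [holomorphic_intros]:
  assumes "\<nu> > -1" "g holomorphic_on A"
  shows "(\<lambda>x. bessel_phi' \<nu> (g x)) holomorphic_on A"
proof -
  have "bessel_phi' \<nu> holomorphic_on UNIV"
    unfolding bessel_phi'_def by (intro holomorphic_intros) (simp add: fps_conv_radius_bessel_deriv[OF assms(1)])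
  from holomorphic_on_compose_gen[OF assms(2) this] show ?thesis by (simp add: o_def)
qed

section \<open>The Bessel function in terms of Phi\<close>

text \<open>For \<nu> > -1 the Pochhammer symbols do not vanish, so every reciprocal Gamma value
  reduces to the one at \<nu> + 1; the integer part 2n of the exponent splits off from the principal
  power without a change of branch.\<close>

lemma bessel_J_eq:
  assumes "\<nu> > -1" "z \<noteq> 0"
  shows "bessel_J \<nu> z = (z / 2) powr of_real \<nu> * rGamma (of_real \<nu> + 1) * bessel_phi \<nu> (z\<^sup>2)"
proof -
  have "(-1) ^ n / fact n * rGamma (of_nat n + of_real \<nu> + 1) * (z / 2) powr (2 * of_nat n + of_real \<nu>)
      = (z / 2) powr of_real \<nu> * rGamma (of_real \<nu> + 1) * (of_real (bessel_coeff \<nu> n) * (z\<^sup>2) ^ n)" for n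
  proof -
    have pos: "pochhammer (\<nu> + 1) n > 0" using assms by (intro pochhammer_pos) auto
    have "rGamma (of_real \<nu> + 1) = of_real (pochhammer (\<nu> + 1) n) * rGamma (of_nat n + of_real \<nu> + 1 :: complex)"
      using pochhammer_rGamma[of "of_real \<nu> + 1 :: complex" n] pochhammer_of_real[of "\<nu> + 1" n, where 'a = complex]
      by (simp add: add_ac)
    then have rG: "rGamma (of_nat n + of_real \<nu> + 1 :: complex) = rGamma (of_real \<nu> + 1) / of_real (pochhammer (\<nu> + 1) n)"
      using pos by (simp add: field_simps)
    have "(z / 2) powr (2 * of_nat n) = (z / 2) ^ (2 * n)"
      using powr_nat[of "z / 2" "2 * n"] assms(2) by simp
    then have pw: "(z / 2) powr (2 * of_nat n + of_real \<nu>) = (z\<^sup>2) ^ n / 4 ^ n * (z / 2) powr of_real \<nu>"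
      by (simp add: powr_add power_mult power_divide)
    have c: "complex_of_real (bessel_coeff \<nu> n) = (-1) ^ n / 4 ^ n / (fact n * of_real (pochhammer (\<nu> + 1) n))"
      unfolding bessel_coeff_def power_divide by simp
    show ?thesis unfolding rG pw c by (simp add: mult_ac)
  qed
  then show ?thesis
    using sums_mult[OF bessel_phi_sums[OF assms(1), of "z\<^sup>2"], of "(z / 2) powr of_real \<nu> * rGamma (of_real \<nu> + 1)"]
    unfolding bessel_J_def by (simp add: sums_iff)
qed

lemma rGamma_nz:
  assumes "\<nu> > -1"
  shows "rGamma (of_real \<nu> + 1 :: complex) \<noteq> 0"
proof -
  have "Gamma (\<nu> + 1) > 0" using assms by (intro Gamma_real_pos) auto
  then have "Gamma (complex_of_real (\<nu> + 1)) \<noteq> 0"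
    by (metis Gamma_complex_of_real less_irrefl of_real_eq_0_iff)
  then show ?thesis by (simp add: rGamma_inverse_Gamma)
qed

lemma deriv_bessel_J_1:
  assumes "\<nu> > -1"
  shows "deriv (bessel_J \<nu>) 1 = (1 / 2) powr of_real \<nu> * rGamma (of_real \<nu> + 1)
      * (of_real \<nu> * bessel_phi \<nu> 1 + 2 * bessel_phi' \<nu> 1)"
proof -
  let ?g = "\<lambda>z. (z / 2) powr of_real \<nu> * rGamma (of_real \<nu> + 1) * bessel_phi \<nu> (z\<^sup>2)"
  have phi: "((\<lambda>z. bessel_phi \<nu> (z\<^sup>2)) has_field_derivative bessel_phi' \<nu> (1\<^sup>2) * 2) (at 1)"
    by (rule DERIV_chain2[OF bessel_phi_deriv[OF assms]]) (auto intro!: derivative_eq_intros)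
  have pw: "((\<lambda>z::complex. (z / 2) powr of_real \<nu>) has_field_derivative of_real \<nu> * (1 / 2) powr of_real \<nu>) (at 1)"
    by (auto intro!: derivative_eq_intros simp: powr_diff complex_nonpos_Reals_iff)
  have d: "(?g has_field_derivative (1 / 2) powr of_real \<nu> * rGamma (of_real \<nu> + 1)
      * (of_real \<nu> * bessel_phi \<nu> 1 + 2 * bessel_phi' \<nu> 1)) (at 1)"
    using DERIV_mult[OF DERIV_cmult_right[OF pw, of "rGamma (of_real \<nu> + 1)"] phi]
    by (simp add: algebra_simps)
  \<comment> \<open>The disc of radius 1 about 1 avoids the point 0, which
    \<open>bessel_J_eq\<close> excludes.\<close>
  have eq: "bessel_J \<nu> z = ?g z" if "z \<in> ball 1 1" for z
    using that assms by (intro bessel_J_eq) auto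
  have "(bessel_J \<nu> has_field_derivative (1 / 2) powr of_real \<nu> * rGamma (of_real \<nu> + 1)
      * (of_real \<nu> * bessel_phi \<nu> 1 + 2 * bessel_phi' \<nu> 1)) (at 1)"
    by (rule has_field_derivative_transform_within_open[where S = "ball 1 1", OF d]) (use eq in auto)
  then show ?thesis by (rule DERIV_imp_deriv)
qed

text \<open>This is the recurrence z J_(\<nu>-1) = z J_\<nu>' + \<nu> J_\<nu> with the powers of z
  removed, checked on coefficients.\<close>

lemma bessel_phi_pred:
  assumes "\<nu> > 0"
  shows "of_real \<nu> * bessel_phi (\<nu> - 1) s = of_real \<nu> * bessel_phi \<nu> s + s * bessel_phi' \<nu> s"
proof -
  have c: "\<nu> * bessel_coeff (\<nu> - 1) n = (\<nu> + n) * bessel_coeff \<nu> n" for n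
  proof -
    have "pochhammer \<nu> n > 0" "pochhammer (\<nu> + 1) n > 0" using assms by (auto intro!: pochhammer_pos)
    moreover have "\<nu> * pochhammer (\<nu> + 1) n = pochhammer \<nu> n * (\<nu> + n)"
      by (metis pochhammer_rec pochhammer_Suc)
    ultimately have "\<nu> / pochhammer \<nu> n = (\<nu> + n) / pochhammer (\<nu> + 1) n"
      by (simp add: field_simps)
    from arg_cong[OF this, of "\<lambda>x. (-1/4) ^ n / fact n * x"] show ?thesis
      unfolding bessel_coeff_def by (simp add: mult_ac)
  qed
  have "(\<lambda>n. s * (of_real (real (Suc n) * bessel_coeff \<nu> (Suc n)) * s ^ n)) sums (s * bessel_phi' \<nu> s)"
    using bessel_phi'_sums[of \<nu> s] assms by (intro sums_mult) auto
  then have "(\<lambda>n. of_real (real (Suc n) * bessel_coeff \<nu> (Suc n)) * s ^ (Suc n)) sums (s * bessel_phi' \<nu> s)"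
    by (simp add: mult_ac)
  then have "(\<lambda>n. of_real (real n * bessel_coeff \<nu> n) * s ^ n) sums (s * bessel_phi' \<nu> s)"
    by (subst (asm) sums_Suc_iff) simp
  moreover have "(\<lambda>n. of_real \<nu> * (of_real (bessel_coeff \<nu> n) * s ^ n)) sums (of_real \<nu> * bessel_phi \<nu> s)"
    using bessel_phi_sums[of \<nu> s] assms by (intro sums_mult) auto
  ultimately have "(\<lambda>n. of_real \<nu> * (of_real (bessel_coeff \<nu> n) * s ^ n) + of_real (real n * bessel_coeff \<nu> n) * s ^ n)
     sums (of_real \<nu> * bessel_phi \<nu> s + s * bessel_phi' \<nu> s)" by (intro sums_add)
  moreover have "of_real \<nu> * (of_real (bessel_coeff \<nu> n) * s ^ n) + of_real (real n * bessel_coeff \<nu> n) * s ^ n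
      = of_real \<nu> * (of_real (bessel_coeff (\<nu> - 1) n) * s ^ n)" for n
    using arg_cong[OF c[of n], of "\<lambda>x. complex_of_real x * s ^ n"] by (simp add: algebra_simps)
  moreover have "(\<lambda>n. of_real \<nu> * (of_real (bessel_coeff (\<nu> - 1) n) * s ^ n)) sums (of_real \<nu> * bessel_phi (\<nu> - 1) s)"
    using bessel_phi_sums[of "\<nu> - 1" s] assms by (intro sums_mult) auto
  ultimately show ?thesis by (metis (no_types, lifting) sums_unique2 sums_cong)
qed

lemma bessel_J_pred_1:
  assumes "\<nu> > 0"
  shows "bessel_J (\<nu> - 1) 1 = (1 / 2) powr of_real \<nu> * rGamma (of_real \<nu> + 1)
     * (2 * (of_real \<nu> * bessel_phi \<nu> 1 + bessel_phi' \<nu> 1))"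
proof -
  have "bessel_J (\<nu> - 1) 1 = (1 / 2) powr (of_real \<nu> - 1) * rGamma (of_real \<nu>) * bessel_phi (\<nu> - 1) 1"
    using bessel_J_eq[of "\<nu> - 1" 1] assms by simp
  also have "rGamma (of_real \<nu> :: complex) = of_real \<nu> * rGamma (of_real \<nu> + 1)"
    using rGamma_plus1[of "of_real \<nu> :: complex"] by simp
  finally have "bessel_J (\<nu> - 1) 1 = (1 / 2) powr of_real \<nu> * rGamma (of_real \<nu> + 1)
     * (2 * (of_real \<nu> * bessel_phi (\<nu> - 1) 1))"
    by (simp add: powr_diff)
  then show ?thesis using bessel_phi_pred[OF assms, of 1] by simp
qed

section \<open>The normalized function and its first two derivatives\<close>

text \<open>Since Ln (z/2) = Ln z - ln 2 without exception, the three inner powers multiply to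
  exactly 1 even on the branch cut. What remains under the outer power is Phi(z^2), which is entire
  with value 1 at 0; at z = 0 both sides vanish through the factor z.\<close>

lemma is_bessel_f_iff:
  assumes "\<nu> > -1"
  shows "is_bessel_f \<nu> f \<longleftrightarrow> f holomorphic_on ball 0 1 \<and>
    (\<forall>\<^sub>F z in nhds 0. f z = z * bessel_phi \<nu> (z\<^sup>2) powr (1 / of_real \<nu>))"
proof -
  have eq: "z * (2 powr of_real \<nu> * Gamma (of_real \<nu> + 1) * z powr (- of_real \<nu>) * bessel_J \<nu> z) powr (1 / of_real \<nu>)
    = z * bessel_phi \<nu> (z\<^sup>2) powr (1 / of_real \<nu>)" for z
  proof (cases "z = 0")
    case False
    have L: "Ln (z / 2) = Ln z - of_real (ln 2)" "Ln 2 = complex_of_real (ln 2)"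
      using False Ln_divide_of_real[of 2 z] Ln_of_real[of 2] by simp_all
    have "2 powr of_real \<nu> * z powr (- of_real \<nu>) * (z / 2) powr of_real \<nu> = 1"
      using False unfolding powr_def L by (simp flip: exp_add) (simp add: algebra_simps)
    moreover have "Gamma (of_real \<nu> + 1) * rGamma (of_real \<nu> + 1 :: complex) = 1"
      using rGamma_nz[OF assms] by (simp add: rGamma_inverse_Gamma)
    moreover have "2 powr of_real \<nu> * Gamma (of_real \<nu> + 1) * z powr (- of_real \<nu>)
      * ((z / 2) powr of_real \<nu> * rGamma (of_real \<nu> + 1) * bessel_phi \<nu> (z\<^sup>2))
      = (2 powr of_real \<nu> * z powr (- of_real \<nu>) * (z / 2) powr of_real \<nu>)
        * (Gamma (of_real \<nu> + 1) * rGamma (of_real \<nu> + 1)) * bessel_phi \<nu> (z\<^sup>2)"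
      by (simp only: mult_ac)
    ultimately have "2 powr of_real \<nu> * Gamma (of_real \<nu> + 1) * z powr (- of_real \<nu>)
      * ((z / 2) powr of_real \<nu> * rGamma (of_real \<nu> + 1) * bessel_phi \<nu> (z\<^sup>2)) = bessel_phi \<nu> (z\<^sup>2)"
      by simp
    then show ?thesis by (simp only: bessel_J_eq[OF assms False])
  qed simp
  show ?thesis unfolding is_bessel_f_def eq ..
qed

text \<open>This is z f'/f = 1 + 2 s Phi'/(\<nu> Phi), the logarithmic derivative, with denominators
  cleared. In this form both sides are holomorphic on the whole disc, so the identity extends from
  the germ even to points where Phi vanishes or the principal power no longer represents f.\<close>

lemma bessel_f_identity:
  assumes nu: "\<nu> > -1" "\<nu> \<noteq> 0" and f: "is_bessel_f \<nu> f" and z: "z \<in> ball 0 1"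
  shows "of_real \<nu> * z * deriv f z * bessel_phi \<nu> (z\<^sup>2)
     = f z * (of_real \<nu> * bessel_phi \<nu> (z\<^sup>2) + 2 * z\<^sup>2 * bessel_phi' \<nu> (z\<^sup>2))"
proof -
  have holf: "f holomorphic_on ball 0 1"
    and ev: "\<forall>\<^sub>F z in nhds 0. f z = z * bessel_phi \<nu> (z\<^sup>2) powr (1 / of_real \<nu>)"
    using f is_bessel_f_iff[OF nu(1)] by auto
  have "isCont (\<lambda>z. bessel_phi \<nu> (z\<^sup>2)) 0"
    using continuous_on_bessel_phi[OF nu(1), of UNIV "\<lambda>z. z\<^sup>2"]
    by (simp add: continuous_on_eq_continuous_at continuous_on_power)
  \<comment> \<open>In the right half-plane the principal power can be differentiated.\<close>
  then have "\<forall>\<^sub>F z in nhds 0. bessel_phi \<nu> (z\<^sup>2) \<in> {w. Re w > 0}"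
    using topological_tendstoD[of "\<lambda>z. bessel_phi \<nu> (z\<^sup>2)" 1 "at 0" "{w. Re w > 0}"] open_halfspace_Re_gt[of 0]
    by (auto simp: isCont_def eventually_nhds_conv_at)
  with ev have "\<forall>\<^sub>F z in nhds 0. f z = z * bessel_phi \<nu> (z\<^sup>2) powr (1 / of_real \<nu>) \<and> Re (bessel_phi \<nu> (z\<^sup>2)) > 0"
    by eventually_elim auto
  then obtain e0 where e0: "e0 > 0" "\<And>z. dist z 0 < e0 \<Longrightarrow> f z = z * bessel_phi \<nu> (z\<^sup>2) powr (1 / of_real \<nu>) \<and> Re (bessel_phi \<nu> (z\<^sup>2)) > 0"
    unfolding eventually_nhds_metric by auto
  define e where "e = min e0 1"
  have e: "e > 0" "ball 0 e \<subseteq> ball (0::complex) 1"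
    "\<And>z. z \<in> ball 0 e \<Longrightarrow> f z = z * bessel_phi \<nu> (z\<^sup>2) powr (1 / of_real \<nu>)"
    "\<And>z. z \<in> ball 0 e \<Longrightarrow> Re (bessel_phi \<nu> (z\<^sup>2)) > 0"
    using e0 by (auto simp: e_def)
  have local: "of_real \<nu> * z * deriv f z * bessel_phi \<nu> (z\<^sup>2)
     = f z * (of_real \<nu> * bessel_phi \<nu> (z\<^sup>2) + 2 * z\<^sup>2 * bessel_phi' \<nu> (z\<^sup>2))" if z: "z \<in> ball 0 e" for z
  proof -
    define a where "a = 1 / complex_of_real \<nu>"
    define p where "p = bessel_phi \<nu> (z\<^sup>2)"
    have p: "p \<notin> \<real>\<^sub>\<le>\<^sub>0" "p \<noteq> 0" using e(4)[OF z] by (auto simp: p_def complex_nonpos_Reals_iff)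
    have phi: "((\<lambda>z. bessel_phi \<nu> (z\<^sup>2)) has_field_derivative bessel_phi' \<nu> (z\<^sup>2) * (2 * z)) (at z)"
      by (rule DERIV_chain2[OF bessel_phi_deriv[OF nu(1)]]) (auto intro!: derivative_eq_intros)
    have "((\<lambda>z. z * bessel_phi \<nu> (z\<^sup>2) powr a) has_field_derivative
        p powr a + z * (a * p powr (a - 1) * (bessel_phi' \<nu> (z\<^sup>2) * (2 * z)))) (at z)"
      using DERIV_mult[OF DERIV_ident DERIV_chain2[OF has_field_derivative_powr[OF p(1)[unfolded p_def]] phi], of a]
      by (simp add: p_def algebra_simps)
    then have "(f has_field_derivative p powr a + z * (a * p powr (a - 1) * (bessel_phi' \<nu> (z\<^sup>2) * (2 * z)))) (at z)"
      by (rule has_field_derivative_transform_within_open[OF _ open_ball z]) (simp add: e(3) a_def)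
    then have "deriv f z = p powr a + z * (a * p powr (a - 1) * (bessel_phi' \<nu> (z\<^sup>2) * (2 * z)))"
      by (rule DERIV_imp_deriv)
    moreover have "p powr (a - 1) = p powr a / p" using p by (simp add: powr_diff)
    moreover have "f z = z * p powr a" using e(3)[OF z] by (simp add: p_def a_def)
    ultimately show ?thesis using nu p
      unfolding p_def[symmetric] by (simp add: a_def field_simps power2_eq_square)
  qed
  have hol1: "(\<lambda>z. of_real \<nu> * z * deriv f z * bessel_phi \<nu> (z\<^sup>2)) holomorphic_on ball 0 1"
    by (intro holomorphic_intros holf nu) auto
  have hol2: "(\<lambda>z. f z * (of_real \<nu> * bessel_phi \<nu> (z\<^sup>2) + 2 * z\<^sup>2 * bessel_phi' \<nu> (z\<^sup>2))) holomorphic_on ball 0 1"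
    by (intro holomorphic_intros holf nu)
  show ?thesis
    by (rule analytic_continuation_open[OF open_ball open_ball _ connected_ball e(2) hol1 hol2 local z]) (use e in auto)
qed

text \<open>Differentiate the identity once more and eliminate Phi'' by Bessel's equation. P is
  fixed only by its defining relation at the point z, so the formula serves both the power series
  for \<nu> > 0 and the quotient used for negative orders, where that series is not at hand.\<close>

lemma bessel_f_deriv2:
  assumes nu: "\<nu> > -1" "\<nu> \<noteq> 0" and f: "is_bessel_f \<nu> f" and z: "z \<in> ball 0 1" "z \<noteq> 0"
    and nz: "f z \<noteq> 0" "deriv f z \<noteq> 0" "bessel_phi \<nu> (z\<^sup>2) \<noteq> 0"
    and P: "P * bessel_phi \<nu> (z\<^sup>2) = - 2 * z\<^sup>2 * bessel_phi' \<nu> (z\<^sup>2)"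
  shows "P \<noteq> of_real \<nu>"
    "z * (deriv (deriv f) z / deriv f z)
      = (1 - 1 / of_real \<nu>) * P - (z\<^sup>2 - of_real \<nu> * P) / (of_real \<nu> - P)"
proof -
  define n p p' where "n = complex_of_real \<nu>" and "p = bessel_phi \<nu> (z\<^sup>2)" and "p' = bessel_phi' \<nu> (z\<^sup>2)"
  define f1 f2 where "f1 = deriv f z" and "f2 = deriv (deriv f) z"
  note defs = n_def[symmetric] p_def[symmetric] p'_def[symmetric] f1_def[symmetric] f2_def[symmetric]
  have n0: "n \<noteq> 0" using nu by (simp add: n_def)
  have P': "2 * z\<^sup>2 * p' = - P * p" using P unfolding defs by simp
  have id: "n * z * f1 * p = f z * (p * (n - P))"
    using bessel_f_identity[OF nu f z(1)] unfolding defs P' by (simp add: algebra_simps)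
  then show "P \<noteq> of_real \<nu>"
    using nz z n0 unfolding defs by auto
  then have Pn: "n - P \<noteq> 0" by (simp add: n_def)
  have holf: "f holomorphic_on ball 0 1" using f by (simp add: is_bessel_f_def)
  have f1: "(f has_field_derivative f1) (at z)"
    unfolding f1_def by (rule holomorphic_derivI[OF holf open_ball z(1)])
  have f2: "(deriv f has_field_derivative f2) (at z)"
    unfolding f2_def by (rule holomorphic_derivI[OF holomorphic_deriv[OF holf open_ball] open_ball z(1)])
  obtain d where d: "(bessel_phi' \<nu> has_field_derivative d) (at (z\<^sup>2))"
    and ode: "z\<^sup>2 * d + of_real (\<nu> + 1) * p' = - p / 4"
    using bessel_phi'_deriv[OF nu(1), of "z\<^sup>2"] unfolding defs by blast
  have sq: "((\<lambda>z. z\<^sup>2) has_field_derivative 2 * z) (at z)" by (auto intro!: derivative_eq_intros)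
  have phi: "((\<lambda>z. bessel_phi \<nu> (z\<^sup>2)) has_field_derivative p' * (2 * z)) (at z)"
    unfolding p'_def by (rule DERIV_chain2[OF bessel_phi_deriv[OF nu(1)] sq])
  have phi': "((\<lambda>z. bessel_phi' \<nu> (z\<^sup>2)) has_field_derivative d * (2 * z)) (at z)"
    by (rule DERIV_chain2[OF d sq])
  have "((\<lambda>z. of_real \<nu> * z * deriv f z * bessel_phi \<nu> (z\<^sup>2)) has_field_derivative
      n * f1 * p + n * z * f2 * p + n * z * f1 * (p' * (2 * z))) (at z)"
    by (rule derivative_eq_intros phi f2 refl)+ (simp add: defs algebra_simps)
  moreover have "((\<lambda>z. of_real \<nu> * z * deriv f z * bessel_phi \<nu> (z\<^sup>2)) has_field_derivative
      f1 * (n * p + 2 * z\<^sup>2 * p') + f z * (n * (p' * (2 * z)) + 4 * z * p' + 2 * z\<^sup>2 * (d * (2 * z)))) (at z)"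
  proof (rule has_field_derivative_transform_within_open[OF _ open_ball z(1)])
    show "((\<lambda>z. f z * (of_real \<nu> * bessel_phi \<nu> (z\<^sup>2) + 2 * z\<^sup>2 * bessel_phi' \<nu> (z\<^sup>2))) has_field_derivative
      f1 * (n * p + 2 * z\<^sup>2 * p') + f z * (n * (p' * (2 * z)) + 4 * z * p' + 2 * z\<^sup>2 * (d * (2 * z)))) (at z)"
      by (rule derivative_eq_intros phi phi' f1 refl)+ (simp add: defs algebra_simps)
  qed (simp add: bessel_f_identity[OF nu f])
  ultimately have eq: "n * f1 * p + n * z * f2 * p + n * z * f1 * (p' * (2 * z))
     = f1 * (n * p + 2 * z\<^sup>2 * p') + f z * (n * (p' * (2 * z)) + 4 * z * p' + 2 * z\<^sup>2 * (d * (2 * z)))"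
    by (rule DERIV_unique)
  have "z * (n * (p' * (2 * z)) + 4 * z * p' + 2 * z\<^sup>2 * (d * (2 * z)))
     = n * (2 * z\<^sup>2 * p') + 2 * (2 * z\<^sup>2 * p') + 4 * z\<^sup>2 * (z\<^sup>2 * d)"
    by (simp add: algebra_simps power2_eq_square)
  also have "z\<^sup>2 * d = - p / 4 - (n + 1) * p'"
    using ode by (simp add: n_def algebra_simps)
  also have "n * (2 * z\<^sup>2 * p') + 2 * (2 * z\<^sup>2 * p') + 4 * z\<^sup>2 * (- p / 4 - (n + 1) * p')
     = - n * (2 * z\<^sup>2 * p') - z\<^sup>2 * p"
    by (simp add: algebra_simps)
  also have "\<dots> = p * (n * P - z\<^sup>2)" unfolding P' by (simp add: algebra_simps)
  finally have N': "z * (n * (p' * (2 * z)) + 4 * z * p' + 2 * z\<^sup>2 * (d * (2 * z))) = p * (n * P - z\<^sup>2)" .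
  \<comment> \<open>The claim is multiplied by n z f1 p (n - P), so that the differentiated identity
    and \<open>id\<close> can be substituted as they stand.\<close>
  have "n * z * f1 * p * (1 + z * f2 / f1 - P) * (n - P) = (n * f1 * p + n * z * f2 * p + n * z * f1 * (p' * (2 * z))) * z * (n - P)"
    using nz(2) P' unfolding defs by (simp add: field_simps power2_eq_square)
  also have "\<dots> = f1 * z * (n * p - P * p) * (n - P) + f z * (p * (n * P - z\<^sup>2)) * (n - P)"
    unfolding eq N'[symmetric] using P' by (simp add: algebra_simps)
  also have "\<dots> = n * z * f1 * p * ((n - P)\<^sup>2 / n + (n * P - z\<^sup>2))"
  proof -
    have "f1 * z * (n * p - P * p) * (n - P) = n * z * f1 * p * ((n - P)\<^sup>2 / n)"
      using n0 by (simp add: field_simps power2_eq_square)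
    moreover have "f z * (p * (n * P - z\<^sup>2)) * (n - P) = f z * (p * (n - P)) * (n * P - z\<^sup>2)"
      by (simp only: mult_ac)
    ultimately show ?thesis by (simp only: id distrib_left)
  qed
  finally have "(1 + z * f2 / f1 - P) * (n - P) = (n - P)\<^sup>2 / n + (n * P - z\<^sup>2)"
    using nz z n0 unfolding defs by simp
  then have "1 + z * f2 / f1 - P = (n - P) / n + (n * P - z\<^sup>2) / (n - P)"
    using Pn by (simp add: field_simps power2_eq_square)
  then show "z * (deriv (deriv f) z / deriv f z)
      = (1 - 1 / of_real \<nu>) * P - (z\<^sup>2 - of_real \<nu> * P) / (of_real \<nu> - P)"
    unfolding defs using n0 Pn by (simp add: field_simps)
qed

section \<open>Rayleigh sums\<close>

text \<open>The coefficients are bounded by 4^(-n), which sums to 1/3. Hence Phi maps the closed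
  disc into the right half-plane: it has no zeros there and its principal powers are
  holomorphic.\<close>

lemma norm_bessel_phi_minus_1:
  assumes "\<nu> > 0" "norm s \<le> 1"
  shows "norm (bessel_phi \<nu> s - 1) < 1"
proof -
  have "(\<lambda>n. of_real (bessel_coeff \<nu> n) * s ^ n) sums bessel_phi \<nu> s"
    using assms by (intro bessel_phi_sums) auto
  then have sums: "(\<lambda>n. of_real (bessel_coeff \<nu> (Suc n)) * s ^ Suc n) sums (bessel_phi \<nu> s - 1)"
    by (subst sums_Suc_iff) simp
  have le: "norm (of_real (bessel_coeff \<nu> (Suc n)) * s ^ Suc n) \<le> 1 / 4 * (1 / 4) ^ n" for n
  proof -
    have "\<bar>bessel_coeff \<nu> (Suc n)\<bar> \<le> (\<nu> + 1) * \<bar>bessel_coeff \<nu> (Suc n)\<bar>"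
      using assms by (simp add: mult_right_mono[of 1 "\<nu> + 1", simplified])
    also have "\<dots> \<le> (1/4) ^ Suc n / fact (Suc n)" using assms by (intro bessel_coeff_bound) auto
    also have "\<dots> \<le> (1/4) ^ Suc n / 1"
      by (intro divide_left_mono fact_ge_1) auto
    finally have "\<bar>bessel_coeff \<nu> (Suc n)\<bar> * norm s ^ Suc n \<le> (1/4) ^ Suc n * 1"
      using assms by (intro mult_mono power_le_one) auto
    then show ?thesis by (simp add: norm_mult norm_power del: power_Suc) simp
  qed
  have "norm (\<Sum>n. of_real (bessel_coeff \<nu> (Suc n)) * s ^ Suc n) \<le> (\<Sum>n. 1 / 4 * (1 / 4) ^ n)"
    by (rule norm_suminf_le[OF le]) (intro summable_mult summable_geometric, simp)
  then have "norm (bessel_phi \<nu> s - 1) \<le> (\<Sum>n. 1 / 4 * (1 / 4) ^ n)"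
    using sums by (simp only: sums_iff)
  also have "\<dots> = 1 / 3" by (subst suminf_mult) (auto simp: suminf_geometric)
  finally show ?thesis by simp
qed

lemma Re_bessel_phi_pos:
  assumes "\<nu> > 0" "norm s \<le> 1"
  shows "Re (bessel_phi \<nu> s) > 0"
  using norm_bessel_phi_minus_1[OF assms] abs_Re_le_cmod[of "bessel_phi \<nu> s - 1"] by auto

definition bessel_P :: "real \<Rightarrow> complex \<Rightarrow> complex" where
  "bessel_P \<nu> = eval_fps (rayleigh_fps \<nu>)"

definition bessel_P' :: "real \<Rightarrow> complex \<Rightarrow> complex" where
  "bessel_P' \<nu> = eval_fps (fps_deriv (rayleigh_fps \<nu>))"

text \<open>For 0 \<le> x \<le> 1 this is P(x); the next definition is P'(1).\<close>

definition rayleigh_sum :: "real \<Rightarrow> real \<Rightarrow> real" where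
  "rayleigh_sum \<nu> x = (\<Sum>n. rayleigh \<nu> n * x ^ n)"

definition rayleigh_dsum :: "real \<Rightarrow> real" where
  "rayleigh_dsum \<nu> = (\<Sum>n. real n * rayleigh \<nu> n)"

context
  fixes \<nu> :: real
  assumes nu: "\<nu> > 0"
begin

lemma norm_less_conv_radius:
  fixes s :: complex
  assumes "norm s \<le> 1"
  shows "ereal (norm s) < fps_conv_radius (rayleigh_fps \<nu>)"
    "ereal (norm s) < fps_conv_radius (fps_deriv (rayleigh_fps \<nu>))"
proof -
  have "ereal (norm s) \<le> 1" using assms by simp
  then show 1: "ereal (norm s) < fps_conv_radius (rayleigh_fps \<nu>)"
    using fps_conv_radius_rayleigh[OF nu] by (rule order_le_less_trans)
  show "ereal (norm s) < fps_conv_radius (fps_deriv (rayleigh_fps \<nu>))"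
    using less_le_trans[OF 1 fps_conv_radius_deriv] .
qed

lemma summable_rayleigh: "summable (rayleigh \<nu>)"
  using norm_summable_fps[OF norm_less_conv_radius(1)[of 1]] rayleigh_nonneg[OF nu]
  by (simp add: rayleigh_fps_def)

lemma summable_rayleigh_power:
  assumes "0 \<le> x" "x \<le> 1"
  shows "summable (\<lambda>n. rayleigh \<nu> n * x ^ n)"
  by (rule summable_comparison_test[OF _ summable_rayleigh])
     (use assms rayleigh_nonneg[OF nu] in \<open>auto intro!: mult_left_le power_le_one simp: abs_mult\<close>)

lemma summable_n_rayleigh: "summable (\<lambda>n. real n * rayleigh \<nu> n)"
proof -
  have "summable (\<lambda>n. real (Suc n) * rayleigh \<nu> (Suc n))"
    using norm_summable_fps[OF norm_less_conv_radius(2)[of 1]] rayleigh_nonneg[OF nu]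
    by (simp add: rayleigh_fps_def norm_mult del: of_nat_Suc)
  then show ?thesis by (subst (asm) summable_Suc_iff)
qed

lemma bessel_P_of_real:
  assumes "0 \<le> x" "x \<le> 1"
  shows "bessel_P \<nu> (of_real x) = of_real (rayleigh_sum \<nu> x)"
proof -
  have "(\<lambda>n. complex_of_real (rayleigh \<nu> n * x ^ n)) sums of_real (rayleigh_sum \<nu> x)"
    unfolding sums_of_real_iff rayleigh_sum_def
    by (rule summable_sums[OF summable_rayleigh_power[OF assms]])
  then show ?thesis
    unfolding bessel_P_def eval_fps_def by (simp add: rayleigh_fps_def sums_iff)
qed

lemma bessel_P_phi:
  assumes "norm s \<le> 1"
  shows "bessel_P \<nu> s * bessel_phi \<nu> s = - 2 * s * bessel_phi' \<nu> s"
proof -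
  have nu': "\<nu> > -1" using nu by simp
  have r: "fps_conv_radius (fps_X * fps_deriv (bessel_fps \<nu>)) = \<infinity>"
    using fps_conv_radius_mult[of fps_X "fps_deriv (bessel_fps \<nu>)"] fps_conv_radius_bessel_deriv[OF nu'] by simp
  have "rayleigh_fps \<nu> * bessel_fps \<nu> = fps_const (-2) * (fps_X * fps_deriv (bessel_fps \<nu>))"
    using rayleigh_fps_bessel_fps[OF nu] by (simp add: numeral_fps_const mult.assoc flip: fps_const_neg)
  from arg_cong[OF this, of "\<lambda>F. eval_fps F s"] show ?thesis
    by (simp add: eval_fps_mult norm_less_conv_radius[OF assms] r fps_conv_radius_bessel[OF nu']
        fps_conv_radius_bessel_deriv[OF nu'] bessel_P_def bessel_phi_def bessel_phi'_def)
qed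

lemma bessel_P_riccati:
  assumes "norm s \<le> 1"
  shows "2 * s * bessel_P' \<nu> s + 2 * of_real \<nu> * bessel_P \<nu> s = (bessel_P \<nu> s)\<^sup>2 + s"
proof -
  note r = norm_less_conv_radius[OF assms]
  have r1: "ereal (norm s) < fps_conv_radius (fps_X * fps_deriv (rayleigh_fps \<nu>))"
    using less_le_trans[OF _ fps_conv_radius_mult[of fps_X "fps_deriv (rayleigh_fps \<nu>)"]] r by simp
  have r2: "ereal (norm s) < fps_conv_radius (fps_const c * rayleigh_fps \<nu>)" for c
    using less_le_trans[OF _ fps_conv_radius_mult[of "fps_const c" "rayleigh_fps \<nu>"]] r by simp
  have r3: "ereal (norm s) < fps_conv_radius (fps_const c * (fps_X * fps_deriv (rayleigh_fps \<nu>)))" for c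
    using less_le_trans[OF _ fps_conv_radius_mult[of "fps_const c" "fps_X * fps_deriv (rayleigh_fps \<nu>)"]] r1 by simp
  have r4: "ereal (norm s) < fps_conv_radius (rayleigh_fps \<nu> ^ 2)"
    using less_le_trans[OF r(1) fps_conv_radius_power] .
  have "fps_const 2 * (fps_X * fps_deriv (rayleigh_fps \<nu>)) + fps_const (of_real (2 * \<nu>)) * rayleigh_fps \<nu>
      = rayleigh_fps \<nu> ^ 2 + fps_X"
    using rayleigh_fps_riccati[OF nu] by (simp add: numeral_fps_const mult.assoc)
  from arg_cong[OF this, of "\<lambda>F. eval_fps F s"] show ?thesis
    by (simp add: eval_fps_add eval_fps_mult eval_fps_power r r1 r2 r3 r4 bessel_P_def bessel_P'_def mult.assoc)
qed

text \<open>The factor |s|, due to the vanishing constant term, later pays for the division by z in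
  z f''/f'.\<close>

lemma norm_bessel_P_le:
  assumes "norm s \<le> 1"
  shows "norm (bessel_P \<nu> s) \<le> norm s * rayleigh_sum \<nu> 1"
proof -
  have le: "norm (of_real (rayleigh \<nu> n) * s ^ n) \<le> norm s * rayleigh \<nu> n" for n
  proof (cases n)
    case (Suc m)
    have "norm s ^ m \<le> 1" using assms by (intro power_le_one) auto
    then have "rayleigh \<nu> n * (norm s * norm s ^ m) \<le> rayleigh \<nu> n * (norm s * 1)"
      using rayleigh_nonneg[OF nu] by (intro mult_left_mono) auto
    then show ?thesis
      using rayleigh_nonneg[OF nu, of n] by (simp add: norm_mult norm_power Suc mult_ac)
  qed simp
  have "norm (bessel_P \<nu> s) \<le> (\<Sum>n. norm s * rayleigh \<nu> n)"
    using norm_suminf_le[OF le summable_mult[OF summable_rayleigh]]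
    by (simp add: bessel_P_def eval_fps_def rayleigh_fps_def)
  then show ?thesis by (simp add: suminf_mult summable_rayleigh rayleigh_sum_def)
qed

lemma bessel_P'_sums:
  assumes "norm s \<le> 1"
  shows "(\<lambda>n. of_real (real n * rayleigh \<nu> n) * s ^ n) sums (s * bessel_P' \<nu> s)"
proof -
  have "(\<lambda>n. s * (of_real (real (Suc n) * rayleigh \<nu> (Suc n)) * s ^ n)) sums (s * bessel_P' \<nu> s)"
    using sums_mult[OF sums_eval_fps[OF norm_less_conv_radius(2)[OF assms]], of s]
    by (simp add: bessel_P'_def rayleigh_fps_def)
  then have "(\<lambda>n. of_real (real (Suc n) * rayleigh \<nu> (Suc n)) * s ^ Suc n) sums (s * bessel_P' \<nu> s)"
    by (simp add: mult_ac)
  then show ?thesis by (subst (asm) sums_Suc_iff) simp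
qed

lemma norm_bessel_P'_le:
  assumes "norm s \<le> 1"
  shows "norm (s * bessel_P' \<nu> s) \<le> norm s * rayleigh_dsum \<nu>"
proof -
  have le: "norm (of_real (real n * rayleigh \<nu> n) * s ^ n) \<le> norm s * (real n * rayleigh \<nu> n)" for n
  proof (cases n)
    case (Suc m)
    have "norm s ^ m \<le> 1" using assms by (intro power_le_one) auto
    then have "(real n * rayleigh \<nu> n) * (norm s * norm s ^ m) \<le> (real n * rayleigh \<nu> n) * (norm s * 1)"
      using rayleigh_nonneg[OF nu] by (intro mult_left_mono) auto
    moreover have "norm (of_real c * s ^ n) = c * norm s ^ n" if "c \<ge> 0" for c
      using that by (simp add: norm_mult norm_power)
    then have "norm (of_real (real n * rayleigh \<nu> n) * s ^ n) = real n * rayleigh \<nu> n * norm s ^ n"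
      using rayleigh_nonneg[OF nu] by (simp del: of_real_mult)
    ultimately show ?thesis by (simp add: Suc mult_ac del: of_real_mult of_nat_Suc)
  qed simp
  have "norm (s * bessel_P' \<nu> s) \<le> (\<Sum>n. norm s * (real n * rayleigh \<nu> n))"
    using norm_suminf_le[OF le summable_mult[OF summable_n_rayleigh]] bessel_P'_sums[OF assms]
    by (simp add: sums_iff)
  then show ?thesis by (simp add: suminf_mult summable_n_rayleigh rayleigh_dsum_def)
qed

text \<open>The Riccati equation at s = 1; it expresses P'(1) through P(1), so that a single number
  per order has to be computed.\<close>

lemma rayleigh_dsum_eq:
  "2 * rayleigh_dsum \<nu> = (rayleigh_sum \<nu> 1)\<^sup>2 + 1 - 2 * \<nu> * rayleigh_sum \<nu> 1"
proof -
  have "(\<lambda>n. complex_of_real (real n * rayleigh \<nu> n)) sums of_real (rayleigh_dsum \<nu>)"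
    unfolding sums_of_real_iff rayleigh_dsum_def by (rule summable_sums[OF summable_n_rayleigh])
  then have "bessel_P' \<nu> 1 = of_real (rayleigh_dsum \<nu>)"
    using bessel_P'_sums[of 1] by (simp add: sums_iff)
  then have "complex_of_real (2 * rayleigh_dsum \<nu> + 2 * \<nu> * rayleigh_sum \<nu> 1) = of_real ((rayleigh_sum \<nu> 1)\<^sup>2 + 1)"
    using bessel_P_riccati[of 1] bessel_P_of_real[of 1] by simp
  then show ?thesis unfolding of_real_eq_iff by simp
qed

lemma continuous_on_rayleigh_sum: "continuous_on {0..1} (rayleigh_sum \<nu>)"
proof -
  have "ereal x < fps_conv_radius (rayleigh_fps \<nu>)" if "0 \<le> x" "x \<le> 1" for x
    using norm_less_conv_radius(1)[of "of_real x"] that by simp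
  then have "continuous_on {0..1} (\<lambda>x. Re (bessel_P \<nu> (of_real x)))"
    unfolding bessel_P_def by (intro continuous_intros) (auto simp: in_eball_iff)
  then show ?thesis
    by (rule continuous_on_eq) (simp add: bessel_P_of_real)
qed

lemma rayleigh_sum_0: "rayleigh_sum \<nu> 0 = 0"
proof -
  have "rayleigh \<nu> n * 0 ^ n = 0" for n by (cases n) auto
  then show ?thesis by (simp add: rayleigh_sum_def)
qed

lemma rayleigh_sum_ge: "rayleigh_sum \<nu> 1 \<ge> (\<Sum>n<k. rayleigh \<nu> n)"
  unfolding rayleigh_sum_def using rayleigh_nonneg[OF nu] summable_rayleigh
  by (simp add: sum_le_suminf)

lemma rayleigh_sum_le:
  "rayleigh_sum \<nu> 1 \<le> (\<Sum>n<k. rayleigh \<nu> n) + 2 * (1 / (4 * (\<nu> + 1))) ^ k / (1 - 1 / (4 * (\<nu> + 1)))"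
proof -
  let ?r = "1 / (4 * (\<nu> + 1))"
  have r: "0 < ?r" "?r < 1" using nu by (auto simp: field_simps)
  have s: "summable (\<lambda>n. 2 * ?r ^ k * ?r ^ n)" using r by (intro summable_mult summable_geometric) auto
  have "rayleigh_sum \<nu> 1 = (\<Sum>n. rayleigh \<nu> (n + k)) + (\<Sum>n<k. rayleigh \<nu> n)"
    unfolding rayleigh_sum_def using suminf_split_initial_segment[OF summable_rayleigh, of k] by simp
  also have "(\<Sum>n. rayleigh \<nu> (n + k)) \<le> (\<Sum>n. 2 * ?r ^ k * ?r ^ n)"
  proof (rule suminf_le)
    show "rayleigh \<nu> (n + k) \<le> 2 * ?r ^ k * ?r ^ n" for n
      using rayleigh_le[OF nu, of "n + k"] by (simp add: power_add mult_ac)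
    show "summable (\<lambda>n. rayleigh \<nu> (n + k))" using summable_rayleigh by (simp add: summable_iff_shift)
  qed (rule s)
  also have "\<dots> = 2 * ?r ^ k / (1 - ?r)"
    using r by (subst suminf_mult) (auto simp: suminf_geometric summable_geometric)
  finally show ?thesis by linarith
qed

lemma rayleigh_sum_le_two_thirds: "rayleigh_sum \<nu> 1 \<le> 2 / 3"
proof -
  define r where "r = 1 / (4 * (\<nu> + 1))"
  have r: "0 < r" "r \<le> 1 / 4" using nu by (auto simp: r_def field_simps)
  have "rayleigh_sum \<nu> 1 \<le> 2 * r / (1 - r)" using rayleigh_sum_le[of 1] by (simp add: r_def)
  also have "\<dots> \<le> 2 * (1 / 4) / (1 - 1 / 4)" using r by (intro frac_le) auto
  finally show ?thesis by simp
qed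

lemma rayleigh_sum_pos: "rayleigh_sum \<nu> 1 > 0"
  using rayleigh_sum_ge[of 2] nu by (simp add: numeral_2_eq_2 rayleigh_1 less_le_trans[of 0 "1 / (2 * (\<nu> + 1))"])

lemma rayleigh_dsum_nonneg: "rayleigh_dsum \<nu> \<ge> 0"
  unfolding rayleigh_dsum_def using summable_n_rayleigh rayleigh_nonneg[OF nu] by (intro suminf_nonneg) auto

end

section \<open>Dependence on the order\<close>

lemma rayleigh_sum_antimono:
  assumes "0 < \<nu>" "\<nu> < \<mu>"
  shows "rayleigh_sum \<mu> 1 < rayleigh_sum \<nu> 1"
proof -
  have "(\<Sum>n. rayleigh \<nu> n - rayleigh \<mu> n) > 0"
  \<comment> \<open>Strictness comes from the coefficient 1 / (2 (\<nu> + 1)).\<close>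
  proof (rule suminf_pos2[where i = 1])
    show "summable (\<lambda>n. rayleigh \<nu> n - rayleigh \<mu> n)"
      using assms by (intro summable_diff summable_rayleigh) auto
    show "0 \<le> rayleigh \<nu> n - rayleigh \<mu> n" for n using rayleigh_antimono[of \<nu> \<mu> n] assms by simp
    show "0 < rayleigh \<nu> 1 - rayleigh \<mu> 1" using assms by (simp add: rayleigh_1 frac_less2)
  qed
  then show ?thesis
    using assms suminf_diff[OF summable_rayleigh summable_rayleigh, of \<nu> \<mu>] by (simp add: rayleigh_sum_def)
qed

lemma rayleigh_dsum_antimono:
  assumes "0 < \<nu>" "\<nu> \<le> \<mu>"
  shows "rayleigh_dsum \<mu> \<le> rayleigh_dsum \<nu>"
  unfolding rayleigh_dsum_def
  using assms by (intro suminf_le mult_left_mono rayleigh_antimono summable_n_rayleigh) auto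

lemma continuous_on_rayleigh:
  assumes "A \<subseteq> {0<..}"
  shows "continuous_on A (\<lambda>\<nu>. rayleigh \<nu> n)"
proof (induction n rule: less_induct)
  case (less n)
  show ?case
  proof (cases "n = 0")
    case False
    show ?thesis
      unfolding rayleigh_unfold[of _ n]
      by (intro continuous_intros less) (use assms False in \<open>auto simp: add_eq_0_iff subset_iff\<close>)
  qed simp
qed

lemma continuous_on_rayleigh_sum_order:
  assumes "A \<subseteq> {0<..}"
  shows "continuous_on A (\<lambda>\<nu>. rayleigh_sum \<nu> 1)"
proof -
  have "uniform_limit A (\<lambda>n \<nu>. \<Sum>i<n. rayleigh \<nu> i) (\<lambda>\<nu>. \<Sum>i. rayleigh \<nu> i) sequentially"
  proof (rule Weierstrass_m_test)
    show "summable (\<lambda>n. 2 * (1/4::real) ^ n)" by (intro summable_mult summable_geometric) auto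
    show "norm (rayleigh \<nu> n) \<le> 2 * (1/4) ^ n" if "\<nu> \<in> A" for n \<nu>
    proof -
      have nu: "\<nu> > 0" using assms that by auto
      have "rayleigh \<nu> n \<le> 2 * (1 / (4 * (\<nu> + 1))) ^ n" by (rule rayleigh_le[OF nu])
      also have "\<dots> \<le> 2 * (1/4) ^ n" using nu by (intro mult_left_mono power_mono) (auto simp: field_simps)
      finally show ?thesis using rayleigh_nonneg[OF nu, of n] by simp
    qed
  qed
  then have "continuous_on A (\<lambda>\<nu>. \<Sum>i. rayleigh \<nu> i)"
    by (rule uniform_limit_theorem[rotated])
       (auto intro!: always_eventually continuous_intros continuous_on_rayleigh assms)
  then show ?thesis by (simp add: rayleigh_sum_def)
qed

definition convexity_bound :: "real \<Rightarrow> real" where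
  "convexity_bound \<nu> = rayleigh_sum \<nu> 1 / \<nu> + 2 * rayleigh_dsum \<nu> / (\<nu> - rayleigh_sum \<nu> 1)"

text \<open>The defining form displays monotonicity in the order; this one, in \<nu> and \<nu> -
  P(1) alone, serves continuity, the numerical estimates and the comparison with the equation for
  \<nu>1.\<close>

lemma convexity_bound_eq:
  assumes "\<nu> > 0" "rayleigh_sum \<nu> 1 < \<nu>"
  shows "convexity_bound \<nu> = 1 - (\<nu>\<^sup>2 - 1) / (\<nu> - rayleigh_sum \<nu> 1) - (1 / \<nu> - 1) * (\<nu> - rayleigh_sum \<nu> 1)"
  unfolding convexity_bound_def rayleigh_dsum_eq[OF assms(1)] using assms
  by (simp add: field_simps power2_eq_square)

text \<open>P(1) and P'(1) decrease in the order, so in both fractions the numerator does not grow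
  and the positive denominator grows.\<close>

lemma convexity_bound_antimono:
  assumes "0 < \<nu>" "rayleigh_sum \<nu> 1 < \<nu>" "\<nu> < \<mu>"
  shows "convexity_bound \<mu> < convexity_bound \<nu>"
proof -
  have mu: "\<mu> > 0" using assms by simp
  note lt = rayleigh_sum_antimono[OF assms(1,3)]
  have "rayleigh_sum \<mu> 1 / \<mu> < rayleigh_sum \<nu> 1 / \<nu>"
    using lt assms rayleigh_sum_pos[OF mu] by (intro frac_less) auto
  moreover have "2 * rayleigh_dsum \<mu> / (\<mu> - rayleigh_sum \<mu> 1) \<le> 2 * rayleigh_dsum \<nu> / (\<nu> - rayleigh_sum \<nu> 1)"
    using lt assms rayleigh_dsum_antimono[of \<nu> \<mu>] rayleigh_dsum_nonneg[OF mu] rayleigh_dsum_nonneg[OF assms(1)]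
    by (intro frac_le) auto
  ultimately show ?thesis unfolding convexity_bound_def by linarith
qed

section \<open>Numerical bounds\<close>

lemma rayleigh_values:
  fixes \<nu> :: real
  defines "p \<equiv> rayleigh \<nu>"
  shows "p 1 = 1 / (2 + 2 * \<nu>)"
    "p 2 = (p 1)\<^sup>2 / (4 + 2 * \<nu>)"
    "p 3 = 2 * p 1 * p 2 / (6 + 2 * \<nu>)"
    "p 4 = (2 * p 1 * p 3 + (p 2)\<^sup>2) / (8 + 2 * \<nu>)"
    "p 5 = (2 * p 1 * p 4 + 2 * p 2 * p 3) / (10 + 2 * \<nu>)"
    "p 6 = (2 * p 1 * p 5 + 2 * p 2 * p 4 + (p 3)\<^sup>2) / (12 + 2 * \<nu>)"
    "p 7 = (2 * p 1 * p 6 + 2 * p 2 * p 5 + 2 * p 3 * p 4) / (14 + 2 * \<nu>)"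
proof -
  have iv: "{1..<2::nat} = {1}" "{1..<3::nat} = {1,2}" "{1..<4::nat} = {1,2,3}" "{1..<5::nat} = {1,2,3,4}"
    "{1..<6::nat} = {1,2,3,4,5}" "{1..<7::nat} = {1,2,3,4,5,6}" by auto
  show "p 1 = 1 / (2 + 2 * \<nu>)" unfolding p_def by (subst rayleigh_unfold) simp
  show "p 2 = (p 1)\<^sup>2 / (4 + 2 * \<nu>)"
    unfolding p_def rayleigh_unfold[of \<nu> 2] iv by (simp add: power2_eq_square)
  show "p 3 = 2 * p 1 * p 2 / (6 + 2 * \<nu>)"
    unfolding p_def rayleigh_unfold[of \<nu> 3] iv by (simp add: mult_ac)
  show "p 4 = (2 * p 1 * p 3 + (p 2)\<^sup>2) / (8 + 2 * \<nu>)"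
    unfolding p_def rayleigh_unfold[of \<nu> 4] iv by (simp add: power2_eq_square mult_ac)
  show "p 5 = (2 * p 1 * p 4 + 2 * p 2 * p 3) / (10 + 2 * \<nu>)"
    unfolding p_def rayleigh_unfold[of \<nu> 5] iv by (simp add: mult_ac)
  show "p 6 = (2 * p 1 * p 5 + 2 * p 2 * p 4 + (p 3)\<^sup>2) / (12 + 2 * \<nu>)"
    unfolding p_def rayleigh_unfold[of \<nu> 6] iv by (simp add: power2_eq_square mult_ac)
  show "p 7 = (2 * p 1 * p 6 + 2 * p 2 * p 5 + 2 * p 3 * p 4) / (14 + 2 * \<nu>)"
    unfolding p_def rayleigh_unfold[of \<nu> 7] iv by (simp add: mult_ac)
qed

lemma rayleigh_partial_sum:
  "(\<Sum>n<8. rayleigh \<nu> n) = rayleigh \<nu> 1 + rayleigh \<nu> 2 + rayleigh \<nu> 3 + rayleigh \<nu> 4 + rayleigh \<nu> 5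
     + rayleigh \<nu> 6 + rayleigh \<nu> 7"
proof -
  have "{..<8::nat} = {0,1,2,3,4,5,6,7}" by auto
  then show ?thesis by simp
qed

text \<open>Rounded values in the recursion keep the numerators small when particular orders are evaluated.\<close>

lemma rayleigh_sum_ge_of_lower_bounds:
  fixes x1 x2 x3 x4 x5 x6 x7 :: real
  assumes nu: "\<nu> > 0"
    and pos: "0 \<le> x1" "0 \<le> x2" "0 \<le> x3" "0 \<le> x4" "0 \<le> x5" "0 \<le> x6" "0 \<le> x7"
    and x: "x1 * (2 + 2 * \<nu>) \<le> 1"
      "x2 * (4 + 2 * \<nu>) \<le> x1 * x1"
      "x3 * (6 + 2 * \<nu>) \<le> 2 * x1 * x2"
      "x4 * (8 + 2 * \<nu>) \<le> 2 * x1 * x3 + x2 * x2"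
      "x5 * (10 + 2 * \<nu>) \<le> 2 * x1 * x4 + 2 * x2 * x3"
      "x6 * (12 + 2 * \<nu>) \<le> 2 * x1 * x5 + 2 * x2 * x4 + x3 * x3"
      "x7 * (14 + 2 * \<nu>) \<le> 2 * x1 * x6 + 2 * x2 * x5 + 2 * x3 * x4"
  shows "x1 + x2 + x3 + x4 + x5 + x6 + x7 \<le> rayleigh_sum \<nu> 1"
proof -
  note rv = rayleigh_values[of \<nu>]
  have 1: "x1 \<le> rayleigh \<nu> 1"
    using x(1) nu unfolding rv(1) by (simp add: field_simps)
  have 2: "x2 \<le> rayleigh \<nu> 2"
  proof -
    have "x1 * x1 \<le> rayleigh \<nu> 1 * rayleigh \<nu> 1"
      using pos rayleigh_nonneg[OF nu] by (intro add_mono mult_mono mult_nonneg_nonneg add_nonneg_nonneg 1 order_refl) auto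
    then show ?thesis using x(2) nu unfolding rv(2) power2_eq_square by (subst pos_le_divide_eq) linarith+
  qed
  have 3: "x3 \<le> rayleigh \<nu> 3"
  proof -
    have "2 * x1 * x2 \<le> 2 * rayleigh \<nu> 1 * rayleigh \<nu> 2"
      using pos rayleigh_nonneg[OF nu] by (intro add_mono mult_mono mult_nonneg_nonneg add_nonneg_nonneg 1 2 order_refl) auto
    then show ?thesis using x(3) nu unfolding rv(3) power2_eq_square by (subst pos_le_divide_eq) linarith+
  qed
  have 4: "x4 \<le> rayleigh \<nu> 4"
  proof -
    have "2 * x1 * x3 + x2 * x2 \<le> 2 * rayleigh \<nu> 1 * rayleigh \<nu> 3 + rayleigh \<nu> 2 * rayleigh \<nu> 2"
      using pos rayleigh_nonneg[OF nu] by (intro add_mono mult_mono mult_nonneg_nonneg add_nonneg_nonneg 1 2 3 order_refl) auto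
    then show ?thesis using x(4) nu unfolding rv(4) power2_eq_square by (subst pos_le_divide_eq) linarith+
  qed
  have 5: "x5 \<le> rayleigh \<nu> 5"
  proof -
    have "2 * x1 * x4 + 2 * x2 * x3 \<le> 2 * rayleigh \<nu> 1 * rayleigh \<nu> 4 + 2 * rayleigh \<nu> 2 * rayleigh \<nu> 3"
      using pos rayleigh_nonneg[OF nu] by (intro add_mono mult_mono mult_nonneg_nonneg add_nonneg_nonneg 1 2 3 4 order_refl) auto
    then show ?thesis using x(5) nu unfolding rv(5) power2_eq_square by (subst pos_le_divide_eq) linarith+
  qed
  have 6: "x6 \<le> rayleigh \<nu> 6"
  proof -
    have "2 * x1 * x5 + 2 * x2 * x4 + x3 * x3 \<le> 2 * rayleigh \<nu> 1 * rayleigh \<nu> 5 + 2 * rayleigh \<nu> 2 * rayleigh \<nu> 4 + rayleigh \<nu> 3 * rayleigh \<nu> 3"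
      using pos rayleigh_nonneg[OF nu] by (intro add_mono mult_mono mult_nonneg_nonneg add_nonneg_nonneg 1 2 3 4 5 order_refl) auto
    then show ?thesis using x(6) nu unfolding rv(6) power2_eq_square by (subst pos_le_divide_eq) linarith+
  qed
  have 7: "x7 \<le> rayleigh \<nu> 7"
  proof -
    have "2 * x1 * x6 + 2 * x2 * x5 + 2 * x3 * x4 \<le> 2 * rayleigh \<nu> 1 * rayleigh \<nu> 6 + 2 * rayleigh \<nu> 2 * rayleigh \<nu> 5 + 2 * rayleigh \<nu> 3 * rayleigh \<nu> 4"
      using pos rayleigh_nonneg[OF nu] by (intro add_mono mult_mono mult_nonneg_nonneg add_nonneg_nonneg 1 2 3 4 5 6 order_refl) auto
    then show ?thesis using x(7) nu unfolding rv(7) power2_eq_square by (subst pos_le_divide_eq) linarith+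
  qed
  show ?thesis using rayleigh_sum_ge[OF nu, of 8] 1 2 3 4 5 6 7 unfolding rayleigh_partial_sum by linarith
qed

text \<open>Values rounded upwards; beyond the seventh coefficient the geometric majorant bounds the
  tail.\<close>

lemma rayleigh_sum_le_of_upper_bounds:
  fixes x1 x2 x3 x4 x5 x6 x7 :: real
  assumes nu: "\<nu> > 0"
    and pos: "0 \<le> x1" "0 \<le> x2" "0 \<le> x3" "0 \<le> x4" "0 \<le> x5" "0 \<le> x6" "0 \<le> x7"
    and x: "x1 * (2 + 2 * \<nu>) \<ge> 1"
      "x2 * (4 + 2 * \<nu>) \<ge> x1 * x1"
      "x3 * (6 + 2 * \<nu>) \<ge> 2 * x1 * x2"
      "x4 * (8 + 2 * \<nu>) \<ge> 2 * x1 * x3 + x2 * x2"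
      "x5 * (10 + 2 * \<nu>) \<ge> 2 * x1 * x4 + 2 * x2 * x3"
      "x6 * (12 + 2 * \<nu>) \<ge> 2 * x1 * x5 + 2 * x2 * x4 + x3 * x3"
      "x7 * (14 + 2 * \<nu>) \<ge> 2 * x1 * x6 + 2 * x2 * x5 + 2 * x3 * x4"
  shows "rayleigh_sum \<nu> 1 \<le> x1 + x2 + x3 + x4 + x5 + x6 + x7 + 2 * (1 / (4 * (\<nu> + 1))) ^ 8 / (1 - 1 / (4 * (\<nu> + 1)))"
proof -
  note rv = rayleigh_values[of \<nu>]
  have 1: "rayleigh \<nu> 1 \<le> x1"
    using x(1) nu unfolding rv(1) by (simp add: field_simps)
  have 2: "rayleigh \<nu> 2 \<le> x2"
  proof -
    have "rayleigh \<nu> 1 * rayleigh \<nu> 1 \<le> x1 * x1"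
      using pos rayleigh_nonneg[OF nu] by (intro add_mono mult_mono mult_nonneg_nonneg add_nonneg_nonneg 1 order_refl) auto
    then show ?thesis using x(2) nu unfolding rv(2) power2_eq_square by (subst pos_divide_le_eq) linarith+
  qed
  have 3: "rayleigh \<nu> 3 \<le> x3"
  proof -
    have "2 * rayleigh \<nu> 1 * rayleigh \<nu> 2 \<le> 2 * x1 * x2"
      using pos rayleigh_nonneg[OF nu] by (intro add_mono mult_mono mult_nonneg_nonneg add_nonneg_nonneg 1 2 order_refl) auto
    then show ?thesis using x(3) nu unfolding rv(3) power2_eq_square by (subst pos_divide_le_eq) linarith+
  qed
  have 4: "rayleigh \<nu> 4 \<le> x4"
  proof -
    have "2 * rayleigh \<nu> 1 * rayleigh \<nu> 3 + rayleigh \<nu> 2 * rayleigh \<nu> 2 \<le> 2 * x1 * x3 + x2 * x2"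
      using pos rayleigh_nonneg[OF nu] by (intro add_mono mult_mono mult_nonneg_nonneg add_nonneg_nonneg 1 2 3 order_refl) auto
    then show ?thesis using x(4) nu unfolding rv(4) power2_eq_square by (subst pos_divide_le_eq) linarith+
  qed
  have 5: "rayleigh \<nu> 5 \<le> x5"
  proof -
    have "2 * rayleigh \<nu> 1 * rayleigh \<nu> 4 + 2 * rayleigh \<nu> 2 * rayleigh \<nu> 3 \<le> 2 * x1 * x4 + 2 * x2 * x3"
      using pos rayleigh_nonneg[OF nu] by (intro add_mono mult_mono mult_nonneg_nonneg add_nonneg_nonneg 1 2 3 4 order_refl) auto
    then show ?thesis using x(5) nu unfolding rv(5) power2_eq_square by (subst pos_divide_le_eq) linarith+
  qed
  have 6: "rayleigh \<nu> 6 \<le> x6"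
  proof -
    have "2 * rayleigh \<nu> 1 * rayleigh \<nu> 5 + 2 * rayleigh \<nu> 2 * rayleigh \<nu> 4 + rayleigh \<nu> 3 * rayleigh \<nu> 3 \<le> 2 * x1 * x5 + 2 * x2 * x4 + x3 * x3"
      using pos rayleigh_nonneg[OF nu] by (intro add_mono mult_mono mult_nonneg_nonneg add_nonneg_nonneg 1 2 3 4 5 order_refl) auto
    then show ?thesis using x(6) nu unfolding rv(6) power2_eq_square by (subst pos_divide_le_eq) linarith+
  qed
  have 7: "rayleigh \<nu> 7 \<le> x7"
  proof -
    have "2 * rayleigh \<nu> 1 * rayleigh \<nu> 6 + 2 * rayleigh \<nu> 2 * rayleigh \<nu> 5 + 2 * rayleigh \<nu> 3 * rayleigh \<nu> 4 \<le> 2 * x1 * x6 + 2 * x2 * x5 + 2 * x3 * x4"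
      using pos rayleigh_nonneg[OF nu] by (intro add_mono mult_mono mult_nonneg_nonneg add_nonneg_nonneg 1 2 3 4 5 6 order_refl) auto
    then show ?thesis using x(7) nu unfolding rv(7) power2_eq_square by (subst pos_divide_le_eq) linarith+
  qed
  show ?thesis using rayleigh_sum_le[OF nu, of 8] 1 2 3 4 5 6 7 unfolding rayleigh_partial_sum by linarith
qed

text \<open>The orders are the endpoints of 0.39001 +- 0.000005 and 1.4426 +- 0.00005. The witnesses
  are the coefficients from the recursion to ten decimals, rounded down for lower and up for upper
  bounds.\<close>

lemma rayleigh_sum_numeric:
  "rayleigh_sum 0.390005 1 > 0.390005"
  "rayleigh_sum 0.390015 1 < 0.390015"
  "rayleigh_sum 1.44255 1 < 0.211086"
  "rayleigh_sum 1.44265 1 > 0.211076"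
proof -
  show "rayleigh_sum 0.390005 1 > 0.390005"
    by (rule less_le_trans[OF _ rayleigh_sum_ge_of_lower_bounds[where
          ?x1.0 = "0.3597109362" and ?x2.0 = "0.0270693905" and ?x3.0 = "0.0028723131" and
          ?x4.0 = "0.0003188102" and ?x5.0 = "0.0000357015" and ?x6.0 = "0.0000040058" and ?x7.0 = "0.0000004496"]])
      (simp_all add: power_divide)
  show "rayleigh_sum 0.390015 1 < 0.390015"
    by (rule le_less_trans[OF rayleigh_sum_le_of_upper_bounds[where
          ?x1.0 = "0.3597083485" and ?x2.0 = "0.0270688879" and ?x3.0 = "0.0028722307" and
          ?x4.0 = "0.0003187980" and ?x5.0 = "0.0000356998" and ?x6.0 = "0.0000040057" and ?x7.0 = "0.0000004497"]])
      (simp_all add: power_divide)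
  show "rayleigh_sum 1.44255 1 < 0.211086"
    by (rule le_less_trans[OF rayleigh_sum_le_of_upper_bounds[where
          ?x1.0 = "0.2047041003" and ?x2.0 = "0.0060861526" and ?x3.0 = "0.0002804382" and
          ?x4.0 = "0.0000139508" and ?x5.0 = "0.0000007082" and ?x6.0 = "0.0000000362" and ?x7.0 = "0.0000000019"]])
      (simp_all add: power_divide)
  show "rayleigh_sum 1.44265 1 > 0.211076"
    by (rule less_le_trans[OF _ rayleigh_sum_ge_of_lower_bounds[where
          ?x1.0 = "0.2046957198" and ?x2.0 = "0.0060854774" and ?x3.0 = "0.0002803892" and
          ?x4.0 = "0.0000139474" and ?x5.0 = "0.0000007079" and ?x6.0 = "0.0000000361" and ?x7.0 = "0.0000000018"]])
      (simp_all add: power_divide)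
qed

text \<open>For \<nu> > 1 both (\<nu>^2 - 1)/p and (1/\<nu> - 1) p decrease in p = \<nu> - P(1).
  Hence C falls as P(1) grows, and a lower bound on P(1) gives an upper bound on C.\<close>

lemma convexity_bound_less:
  assumes "\<nu> > 1" "L \<le> rayleigh_sum \<nu> 1"
  shows "convexity_bound \<nu> \<le> 1 - ((\<nu>\<^sup>2 - 1) / (\<nu> - L) + (1 / \<nu> - 1) * (\<nu> - L))"
proof -
  have R: "rayleigh_sum \<nu> 1 < \<nu>" using rayleigh_sum_le_two_thirds[of \<nu>] assms by simp
  have "(\<nu>\<^sup>2 - 1) / (\<nu> - L) \<le> (\<nu>\<^sup>2 - 1) / (\<nu> - rayleigh_sum \<nu> 1)"
    using assms R by (intro divide_left_mono mult_pos_pos) auto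
  moreover have "(1 / \<nu> - 1) * (\<nu> - L) \<le> (1 / \<nu> - 1) * (\<nu> - rayleigh_sum \<nu> 1)"
    using assms by (intro mult_left_mono_neg) auto
  ultimately show ?thesis using convexity_bound_eq[OF _ R] assms by linarith
qed

lemma convexity_bound_greater:
  assumes "\<nu> > 1" "rayleigh_sum \<nu> 1 \<le> U" "U < \<nu>"
  shows "convexity_bound \<nu> \<ge> 1 - ((\<nu>\<^sup>2 - 1) / (\<nu> - U) + (1 / \<nu> - 1) * (\<nu> - U))"
proof -
  have R: "rayleigh_sum \<nu> 1 < \<nu>" using assms by simp
  have "(\<nu>\<^sup>2 - 1) / (\<nu> - rayleigh_sum \<nu> 1) \<le> (\<nu>\<^sup>2 - 1) / (\<nu> - U)"
    using assms R by (intro divide_left_mono mult_pos_pos) auto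
  moreover have "(1 / \<nu> - 1) * (\<nu> - rayleigh_sum \<nu> 1) \<le> (1 / \<nu> - 1) * (\<nu> - U)"
    using assms by (intro mult_left_mono_neg) auto
  ultimately show ?thesis using convexity_bound_eq[OF _ R] assms by linarith
qed

lemma convexity_bound_numeric:
  "convexity_bound 1.44255 > 1 / 2"
  "convexity_bound 1.44265 < 1 / 2"
proof -
  show "convexity_bound 1.44255 > 1 / 2"
    by (rule less_le_trans[OF _ convexity_bound_greater[OF _ less_imp_le[OF rayleigh_sum_numeric(3)]]])
       (simp_all add: power2_eq_square)
  show "convexity_bound 1.44265 < 1 / 2"
    by (rule le_less_trans[OF convexity_bound_less[OF _ less_imp_le[OF rayleigh_sum_numeric(4)]]])
       (simp_all add: power2_eq_square)
qed

section \<open>Uniform convexity of the normalized Bessel function\<close>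

lemma deriv_bessel_J_1_eq_0_iff:
  assumes "\<nu> > 0"
  shows "deriv (bessel_J \<nu>) 1 = 0 \<longleftrightarrow> rayleigh_sum \<nu> 1 = \<nu>"
proof -
  have "bessel_phi \<nu> 1 \<noteq> 0" using Re_bessel_phi_pos[OF assms, of 1] by auto
  moreover have "of_real \<nu> * bessel_phi \<nu> 1 + 2 * bessel_phi' \<nu> 1 = of_real (\<nu> - rayleigh_sum \<nu> 1) * bessel_phi \<nu> 1"
    using bessel_P_phi[OF assms, of 1] bessel_P_of_real[OF assms, of 1] by (simp add: algebra_simps)
  ultimately show ?thesis
    using deriv_bessel_J_1[of \<nu>] rGamma_nz[of \<nu>] assms by auto
qed

text \<open>The series for P is not at hand when \<nu> \<le> 0, so the series of \<nu> Phi(1) + 2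
  Phi'(1) is estimated directly. Multiplied by \<nu> + 1, its first two terms give \<nu> (\<nu> + 1)
  - (\<nu> + 2)/4 < -1/4, and the rest is at most 1/6.\<close>

lemma deriv_bessel_J_1_nz:
  assumes "-1 < \<nu>" "\<nu> \<le> 0"
  shows "deriv (bessel_J \<nu>) 1 \<noteq> 0"
proof -
  have arith: "x < 0" if "x - s \<le> 1 / 8 * (1 / (1 - 1 / 4))" "s = a - (\<nu> + 2) / 4" "a \<le> 0" for x s a :: real
    using that assms by (simp add: field_simps)
  define c where "c n = bessel_coeff \<nu> n * (\<nu> + 2 * real n)" for n
  have "(\<lambda>n. complex_of_real \<nu> * (of_real (bessel_coeff \<nu> n) * 1 ^ n)) sums (of_real \<nu> * bessel_phi \<nu> 1)"
    using assms by (intro sums_mult bessel_phi_sums) auto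
  moreover have "(\<lambda>n. 2 * complex_of_real (real n * bessel_coeff \<nu> n)) sums (2 * bessel_phi' \<nu> 1)"
  proof -
    have "(\<lambda>n. complex_of_real (real (Suc n) * bessel_coeff \<nu> (Suc n))) sums bessel_phi' \<nu> 1"
      using bessel_phi'_sums[of \<nu> 1] assms by simp
    then have "(\<lambda>n. complex_of_real (real n * bessel_coeff \<nu> n)) sums bessel_phi' \<nu> 1"
      by (subst (asm) sums_Suc_iff) simp
    then show ?thesis by (rule sums_mult)
  qed
  ultimately have "(\<lambda>n. complex_of_real \<nu> * (of_real (bessel_coeff \<nu> n) * 1 ^ n) + 2 * complex_of_real (real n * bessel_coeff \<nu> n))
      sums (of_real \<nu> * bessel_phi \<nu> 1 + 2 * bessel_phi' \<nu> 1)" by (rule sums_add)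
  moreover have "complex_of_real \<nu> * (of_real (bessel_coeff \<nu> n) * 1 ^ n) + 2 * complex_of_real (real n * bessel_coeff \<nu> n)
      = of_real (c n)" for n
    by (simp add: c_def algebra_simps)
  ultimately have "(\<lambda>n. complex_of_real (c n)) sums (of_real \<nu> * bessel_phi \<nu> 1 + 2 * bessel_phi' \<nu> 1)"
    by simp
  then have "c sums Re (of_real \<nu> * bessel_phi \<nu> 1 + 2 * bessel_phi' \<nu> 1)"
    using sums_Re by fastforce
  then have sums: "(\<lambda>n. (\<nu> + 1) * c n) sums ((\<nu> + 1) * Re (of_real \<nu> * bessel_phi \<nu> 1 + 2 * bessel_phi' \<nu> 1))"
    by (rule sums_mult)
  have le: "(\<nu> + 1) * c (n + 2) \<le> 1 / 8 * (1 / 4) ^ n" for n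
  proof -
    let ?n = "n + 2"
    have "(\<nu> + 1) * c ?n \<le> ((\<nu> + 1) * \<bar>bessel_coeff \<nu> ?n\<bar>) * (\<nu> + 2 * real ?n)"
      using assms by (simp add: c_def mult.assoc mult_left_mono mult_right_mono)
    also have "\<dots> \<le> ((1/4) ^ ?n / fact ?n) * (2 * real ?n)"
      using assms bessel_coeff_bound[of \<nu> ?n] by (intro mult_mono) auto
    also have "\<dots> = 2 * (1/4) ^ ?n / fact (Suc n)"
      by (simp add: divide_simps del: of_nat_Suc)
    also have "\<dots> \<le> 2 * (1/4) ^ ?n / 1"
      by (intro divide_left_mono fact_ge_1) auto
    finally show ?thesis by simp
  qed
  have geo: "(\<lambda>n. 1 / 8 * (1 / 4 :: real) ^ n) sums (1 / 8 * (1 / (1 - 1 / 4)))"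
    by (intro sums_mult geometric_sums) simp
  have "(\<nu> + 1) * Re (of_real \<nu> * bessel_phi \<nu> 1 + 2 * bessel_phi' \<nu> 1) - (\<Sum>n<2. (\<nu> + 1) * c n) \<le> 1 / 8 * (1 / (1 - 1 / 4))"
    by (rule sums_le[OF le sums_split_initial_segment[OF sums, of 2] geo])
  moreover have "(\<Sum>n<2. (\<nu> + 1) * c n) = (\<nu> + 1) * \<nu> - (\<nu> + 2) / 4"
    using assms by (simp add: c_def numeral_2_eq_2 bessel_coeff_def field_simps)
  moreover have "(\<nu> + 1) * \<nu> \<le> 0" using assms by (intro mult_nonneg_nonpos) auto
  ultimately have "(\<nu> + 1) * Re (of_real \<nu> * bessel_phi \<nu> 1 + 2 * bessel_phi' \<nu> 1) < 0"
    by (rule arith)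
  then have "of_real \<nu> * bessel_phi \<nu> 1 + 2 * bessel_phi' \<nu> 1 \<noteq> 0" by (metis less_irrefl mult_zero_right zero_complex.sel(1))
  then show ?thesis using deriv_bessel_J_1[of \<nu>] rGamma_nz[of \<nu>] assms by auto
qed

text \<open>With p = \<nu> - P(1) = J_\<nu>'(1)/J_\<nu>(1) the recurrence gives J_(\<nu>-1)(1) = (p
  + \<nu>) J_\<nu>(1). Division by the square of J_\<nu>(1) leaves a quadratic polynomial in p, and
  this is 2 \<nu> p (1/2 - C).\<close>

lemma nu1_equation_iff:
  assumes "\<nu> > 0" "rayleigh_sum \<nu> 1 < \<nu>"
  shows "nu1_equation \<nu> \<longleftrightarrow> convexity_bound \<nu> = 1 / 2"
proof -
  define A p where "A = (1 / 2) powr of_real \<nu> * rGamma (of_real \<nu> + 1) * bessel_phi \<nu> 1"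
    and "p = \<nu> - rayleigh_sum \<nu> 1"
  have p: "p > 0" using assms by (simp add: p_def)
  have "bessel_phi \<nu> 1 \<noteq> 0" using Re_bessel_phi_pos[OF assms(1), of 1] by auto
  then have A: "A \<noteq> 0" using rGamma_nz[of \<nu>] assms by (simp add: A_def)
  have J: "bessel_J \<nu> 1 = A" using bessel_J_eq[of \<nu> 1] assms by (simp add: A_def)
  have "2 * bessel_phi' \<nu> 1 = - of_real (rayleigh_sum \<nu> 1) * bessel_phi \<nu> 1"
    using bessel_P_phi[OF assms(1), of 1] bessel_P_of_real[OF assms(1), of 1] by simp
  then have "2 * (of_real \<nu> * bessel_phi \<nu> 1 + bessel_phi' \<nu> 1) = of_real (p + \<nu>) * bessel_phi \<nu> 1"
    by (simp add: p_def algebra_simps)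
  then have J': "bessel_J (\<nu> - 1) 1 = A * of_real (p + \<nu>)"
    unfolding bessel_J_pred_1[OF assms(1)] A_def by (simp add: mult_ac)
  have "nu1_equation \<nu> \<longleftrightarrow> A\<^sup>2 * of_real (\<nu> * (3 * \<nu> - 2) + \<nu> * (4 * \<nu> - 5) * (p + \<nu>) + 2 * (1 - \<nu>) * (p + \<nu>)\<^sup>2) = 0"
    unfolding nu1_equation_def J J'
    by (rule arg_cong[where f = "\<lambda>x. x = 0"]) (simp add: algebra_simps power2_eq_square)
  also have "\<dots> \<longleftrightarrow> \<nu> * (3 * \<nu> - 2) + \<nu> * (4 * \<nu> - 5) * (p + \<nu>) + 2 * (1 - \<nu>) * (p + \<nu>)\<^sup>2 = 0"
    using A by (simp only: mult_eq_0_iff of_real_eq_0_iff) simp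
  also have "\<nu> * (3 * \<nu> - 2) + \<nu> * (4 * \<nu> - 5) * (p + \<nu>) + 2 * (1 - \<nu>) * (p + \<nu>)\<^sup>2
     = 2 * (1 - \<nu>) * p\<^sup>2 - \<nu> * p + 2 * \<nu> * (\<nu>\<^sup>2 - 1)"
    by (simp add: algebra_simps power2_eq_square)
  also have "\<dots> = 2 * \<nu> * p * (1 / 2 - convexity_bound \<nu>)"
    unfolding convexity_bound_eq[OF assms] p_def[symmetric] using p assms
    by (simp add: field_simps power2_eq_square)
  finally show ?thesis using p assms by auto
qed

section \<open>Positive orders: sufficiency and necessity\<close>

text \<open>For \<nu> > 0 the values Phi(z^2) stay in the right half-plane, so the principal power
  defines f on the whole disc.\<close>

lemma bessel_f_exists_uniformly_convex:
  assumes nu: "\<nu> > 0" and R: "rayleigh_sum \<nu> 1 < \<nu>" and C: "convexity_bound \<nu> \<le> 1 / 2"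
  shows "\<exists>f. is_bessel_f \<nu> f \<and> uniformly_convex f"
proof -
  let ?B = "ball (0::complex) 1"
  define a where "a = 1 / complex_of_real \<nu>"
  define h where "h z = bessel_phi \<nu> (z\<^sup>2) powr a" for z
  define f where "f z = z * h z" for z
  have nu': "\<nu> > -1" using nu by simp
  have sq: "norm (z\<^sup>2) \<le> 1" if "z \<in> ?B" for z
    using that power_le_one[of "norm z" 2] by (simp add: norm_power)
  have Re_pos: "Re (bessel_phi \<nu> (z\<^sup>2)) > 0" if "z \<in> ?B" for z
    using Re_bessel_phi_pos[OF nu sq[OF that]] .
  have nz_phi: "bessel_phi \<nu> (z\<^sup>2) \<noteq> 0" if "z \<in> ?B" for z
    using Re_pos[OF that] by auto
  have "bessel_phi \<nu> (z\<^sup>2) \<notin> \<real>\<^sub>\<le>\<^sub>0" if "z \<in> ?B" for z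
    using Re_pos[OF that] by (auto simp: complex_nonpos_Reals_iff)
  then have holh: "h holomorphic_on ?B"
    unfolding h_def[abs_def] by (intro holomorphic_intros nu') auto
  then have holf: "f holomorphic_on ?B"
    unfolding f_def[abs_def] by (intro holomorphic_intros) auto
  have bf: "is_bessel_f \<nu> f"
    unfolding is_bessel_f_iff[OF nu'] using holf by (simp add: f_def h_def a_def)
  have f0: "f 0 = 0" by (simp add: f_def)
  have "(f has_field_derivative 1 * h 0 + deriv h 0 * 0) (at 0)"
    unfolding f_def[abs_def] by (intro DERIV_mult DERIV_ident holomorphic_derivI[OF holh]) auto
  then have f'0: "deriv f 0 = 1"
    by (simp add: DERIV_imp_deriv h_def)
  have P_less: "norm (bessel_P \<nu> (z\<^sup>2)) \<le> rayleigh_sum \<nu> 1" if "z \<in> ?B" for z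
    by (rule order_trans[OF norm_bessel_P_le[OF nu sq[OF that]] mult_left_le_one_le[OF _ _ sq[OF that]]])
       (use rayleigh_sum_pos[OF nu] in auto)
  have norm_diff: "norm (of_real \<nu> - bessel_P \<nu> (z\<^sup>2)) \<ge> \<nu> - rayleigh_sum \<nu> 1" if "z \<in> ?B" for z
    using P_less[OF that] norm_triangle_ineq2[of "of_real \<nu>" "bessel_P \<nu> (z\<^sup>2)"] nu by simp
  then have nz_diff: "of_real \<nu> - bessel_P \<nu> (z\<^sup>2) \<noteq> 0" if "z \<in> ?B" for z
    using that R by fastforce
  have nz_f: "f z \<noteq> 0" if "z \<in> ?B" "z \<noteq> 0" for z
    using nz_phi[OF that(1)] that(2) by (simp add: f_def h_def)
  have nz_f': "deriv f z \<noteq> 0" if z: "z \<in> ?B" for z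
  proof (cases "z = 0")
    case False
    have "of_real \<nu> * z * deriv f z * bessel_phi \<nu> (z\<^sup>2)
       = f z * (bessel_phi \<nu> (z\<^sup>2) * (of_real \<nu> - bessel_P \<nu> (z\<^sup>2)))"
      using bessel_f_identity[OF nu' _ bf z] bessel_P_phi[OF nu sq[OF z]] nu by (simp add: algebra_simps)
    then show ?thesis using nz_phi[OF z] nz_diff[OF z] nz_f[OF z False] by auto
  qed (use f'0 in auto)
  define q where "q z = deriv (deriv f) z / deriv f z" for z
  have q_le: "norm (q z) \<le> 1 / 2" if z: "z \<in> ?B" "z \<noteq> 0" for z
  proof -
    define P where "P = bessel_P \<nu> (z\<^sup>2)"
    define S where "S = z\<^sup>2 * bessel_P' \<nu> (z\<^sup>2)"
    have Pn: "of_real \<nu> - P \<noteq> 0" using nz_diff[OF z(1)] by (simp add: P_def)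
    \<comment> \<open>The Riccati equation splits the numerator so that P/\<nu> and 2 s P'/(\<nu> -
      P) appear with equal sign; a termwise estimate then loses nothing at s = 1.\<close>
    have S: "z\<^sup>2 - of_real \<nu> * P = 2 * S + P * (of_real \<nu> - P)"
      using bessel_P_riccati[OF nu sq[OF z(1)]] by (simp add: S_def P_def algebra_simps power2_eq_square)
    have "z * q z = (1 - 1 / of_real \<nu>) * P - (z\<^sup>2 - of_real \<nu> * P) / (of_real \<nu> - P)"
      unfolding q_def P_def using nu
      by (intro bessel_f_deriv2[OF nu' _ bf z nz_f[OF z] nz_f'[OF z(1)] nz_phi[OF z(1)]])
         (auto simp: bessel_P_phi[OF nu sq[OF z(1)]])
    also have "\<dots> = - (P / of_real \<nu> + 2 * S / (of_real \<nu> - P))"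
      unfolding S using Pn nu by (simp add: field_simps)
    finally have "norm z * norm (q z) = norm (P / of_real \<nu> + 2 * S / (of_real \<nu> - P))"
      by (metis norm_minus_cancel norm_mult)
    also have "\<dots> \<le> norm (P / of_real \<nu>) + norm (2 * S / (of_real \<nu> - P))" by (rule norm_triangle_ineq)
    also have "norm (P / of_real \<nu>) \<le> (norm z)\<^sup>2 * rayleigh_sum \<nu> 1 / \<nu>"
      using norm_bessel_P_le[OF nu sq[OF z(1)]] nu by (simp add: P_def norm_divide norm_power divide_right_mono)
    also have "norm (2 * S / (of_real \<nu> - P)) \<le> 2 * ((norm z)\<^sup>2 * rayleigh_dsum \<nu>) / (\<nu> - rayleigh_sum \<nu> 1)"
      unfolding norm_divide norm_mult
      using norm_bessel_P'_le[OF nu sq[OF z(1)]] norm_diff[OF z(1)] R rayleigh_dsum_nonneg[OF nu]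
      by (intro frac_le) (auto simp: S_def P_def norm_power)
    also have "(norm z)\<^sup>2 * rayleigh_sum \<nu> 1 / \<nu> + 2 * ((norm z)\<^sup>2 * rayleigh_dsum \<nu>) / (\<nu> - rayleigh_sum \<nu> 1)
       = (norm z)\<^sup>2 * convexity_bound \<nu>"
      by (simp add: convexity_bound_def algebra_simps)
    also have "\<dots> \<le> (norm z)\<^sup>2 * (1 / 2)" using C by (intro mult_left_mono) auto
    also have "\<dots> = norm z * (norm z * (1 / 2))" by (simp add: power2_eq_square)
    finally have "norm (q z) \<le> norm z * (1 / 2)" using z(2) by (simp add: mult_le_cancel_left)
    then show ?thesis using z(1) by simp
  qed
  \<comment> \<open>At 0 the formula for z f''/f' says nothing about f''/f'; the bound passes there
    by continuity.\<close>
  have "norm (q z) \<le> 1 / 2" if z: "z \<in> ?B" for z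
  proof (cases "z = 0")
    case True
    have "q holomorphic_on ?B"
      unfolding q_def[abs_def] using nz_f' by (intro holomorphic_intros holf) auto
    then have "isCont q 0"
      using holomorphic_on_imp_continuous_on continuous_on_eq_continuous_at[OF open_ball] by force
    then have "(q \<longlongrightarrow> q 0) (at 0)" by (simp add: isCont_def)
    moreover have "\<forall>\<^sub>F z in at 0. norm (q z) \<le> 1 / 2"
      using q_le by (auto simp: eventually_at intro!: exI[of _ 1])
    ultimately show ?thesis using True by (metis Lim_norm_ubound trivial_limit_at)
  qed (use q_le z in auto)
  then have "uniformly_convex f"
    unfolding q_def by (intro uniformly_convexI holf f0 f'0 nz_f') auto
  with bf show ?thesis by blast
qed

text \<open>On the positive real axis all quantities are real. P starts at 0 and cannot take the
  value \<nu> on (0,1), as f' would vanish there; hence P < \<nu>. The inequality from the arcs is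
  then carried to t = 1.\<close>

lemma bessel_f_uniformly_convexD:
  assumes nu: "\<nu> > 0" and bf: "is_bessel_f \<nu> f" and uc: "uniformly_convex f"
  shows "rayleigh_sum \<nu> 1 < \<nu>" "convexity_bound \<nu> \<le> 1 / 2"
proof -
  define \<rho> where "\<rho> = rayleigh_sum \<nu>"
  have holf: "f holomorphic_on ball 0 1" and inj: "inj_on f (ball 0 1)" and f0: "f 0 = 0"
    using uc by (auto simp: uniformly_convex_def)
  have cont: "continuous_on {0..1} \<rho>" using continuous_on_rayleigh_sum[OF nu] by (simp add: \<rho>_def)
  have main: "\<rho> t \<noteq> \<nu>" "(1 - 1 / \<nu>) * \<rho> t - (t - \<nu> * \<rho> t) / (\<nu> - \<rho> t) \<ge> - 1 / 2" if t: "0 < t" "t < 1" for t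
  proof -
    define z where "z = complex_of_real (sqrt t)"
    have z: "z \<in> ball 0 1" "z \<noteq> 0" "z\<^sup>2 = of_real t"
      using t by (auto simp: z_def simp flip: of_real_power)
    have nt: "norm (complex_of_real t) \<le> 1" using t by simp
    have P: "of_real (\<rho> t) * bessel_phi \<nu> (z\<^sup>2) = - 2 * z\<^sup>2 * bessel_phi' \<nu> (z\<^sup>2)"
      using bessel_P_phi[OF nu nt] bessel_P_of_real[OF nu, of t] t by (simp add: z(3) \<rho>_def)
    have nz: "f z \<noteq> 0" "deriv f z \<noteq> 0" "bessel_phi \<nu> (z\<^sup>2) \<noteq> 0"
      using inj_onD[OF inj, of z 0] z f0 holomorphic_injective_imp_regular[OF holf open_ball inj z(1)]
        Re_bessel_phi_pos[OF nu nt] by (auto simp: z(3))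
    have nu': "\<nu> > -1" "\<nu> \<noteq> 0" using nu by auto
    note d = bessel_f_deriv2[OF nu' bf z(1,2) nz P]
    show "\<rho> t \<noteq> \<nu>" using d(1) by auto
    have "z * (deriv (deriv f) z / deriv f z) = of_real ((1 - 1 / \<nu>) * \<rho> t - (t - \<nu> * \<rho> t) / (\<nu> - \<rho> t))"
      unfolding d(2) z(3) by simp
    then show "(1 - 1 / \<nu>) * \<rho> t - (t - \<nu> * \<rho> t) / (\<nu> - \<rho> t) \<ge> - 1 / 2"
      using uniformly_convexD[OF uc z(1,2)] by (simp only: Re_complex_of_real)
  qed
  have less: "\<rho> t < \<nu>" if t: "0 < t" "t < 1" for t
  proof (rule ccontr)
    assume "\<not> \<rho> t < \<nu>"
    moreover have "\<rho> 0 = 0" using rayleigh_sum_0[OF nu] by (simp add: \<rho>_def)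
    moreover have "continuous_on {0..t} \<rho>" using cont by (rule continuous_on_subset) (use t in auto)
    ultimately obtain x where "0 \<le> x" "x \<le> t" "\<rho> x = \<nu>"
      using IVT'[of \<rho> 0 \<nu> t] nu t by auto
    moreover have "x \<noteq> 0" using \<open>\<rho> 0 = 0\<close> \<open>\<rho> x = \<nu>\<close> nu by auto
    ultimately show False using main(1)[of x] t by auto
  qed
  have cl: "closure {0<..<1::real} = {0..1}" by (simp add: closure_greaterThanLessThan)
  have "\<nu> - \<rho> 1 \<ge> 0"
    by (rule continuous_ge_on_closure[where S = "{0<..<1}" and f = "\<lambda>t. \<nu> - \<rho> t"])
       (use cont less in \<open>auto simp: cl intro!: continuous_intros less_imp_le\<close>)
  \<comment> \<open>The inequality is multiplied by \<nu> - P(t) before the limit, since at this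
    stage \<nu> - P(1) might be 0.\<close>
  have "(\<nu> - \<rho> 1) / 2 + (1 - 1 / \<nu>) * \<rho> 1 * (\<nu> - \<rho> 1) - (1 - \<nu> * \<rho> 1) \<ge> 0"
  proof (rule continuous_ge_on_closure[where S = "{0<..<1}"
        and f = "\<lambda>t. (\<nu> - \<rho> t) / 2 + (1 - 1 / \<nu>) * \<rho> t * (\<nu> - \<rho> t) - (t - \<nu> * \<rho> t)"])
    show "continuous_on (closure {0<..<1}) (\<lambda>t. (\<nu> - \<rho> t) / 2 + (1 - 1 / \<nu>) * \<rho> t * (\<nu> - \<rho> t) - (t - \<nu> * \<rho> t))"
      unfolding cl by (intro continuous_intros cont) auto
    fix t :: real assume t: "t \<in> {0<..<1}"
    have "(\<nu> - \<rho> t) / 2 + (1 - 1 / \<nu>) * \<rho> t * (\<nu> - \<rho> t) - (t - \<nu> * \<rho> t)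
       = (1 / 2 + ((1 - 1 / \<nu>) * \<rho> t - (t - \<nu> * \<rho> t) / (\<nu> - \<rho> t))) * (\<nu> - \<rho> t)"
      using less[of t] t by (simp add: field_simps)
    also have "\<dots> \<ge> 0" using less[of t] main(2)[of t] t by (intro mult_nonneg_nonneg) auto
    finally show "(\<nu> - \<rho> t) / 2 + (1 - 1 / \<nu>) * \<rho> t * (\<nu> - \<rho> t) - (t - \<nu> * \<rho> t) \<ge> 0" .
  qed (simp add: cl)
  then have ineq: "(\<nu> - \<rho> 1) / 2 + (1 - 1 / \<nu>) * \<rho> 1 * (\<nu> - \<rho> 1) \<ge> 1 - \<nu> * \<rho> 1" by simp
  \<comment> \<open>If P(1) = \<nu>, the limit inequality reads \<nu>^2 \<ge> 1, against P(1) \<le>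
    2/3.\<close>
  have "\<rho> 1 \<noteq> \<nu>"
  proof
    assume eq: "\<rho> 1 = \<nu>"
    then have "1 \<le> \<nu> * \<nu>" using ineq by simp
    moreover have "\<nu> \<le> 2 / 3" using rayleigh_sum_le_two_thirds[OF nu] eq by (simp add: \<rho>_def)
    then have "\<nu> * \<nu> \<le> 2 / 3 * (2 / 3)" using nu by (intro mult_mono) auto
    ultimately show False by simp
  qed
  with \<open>\<nu> - \<rho> 1 \<ge> 0\<close> have R: "\<rho> 1 < \<nu>" by simp
  then show "rayleigh_sum \<nu> 1 < \<nu>" by (simp add: \<rho>_def)
  have "convexity_bound \<nu> * (\<nu> - \<rho> 1) = (1 - \<nu> * \<rho> 1) - (1 - 1 / \<nu>) * \<rho> 1 * (\<nu> - \<rho> 1)"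
    unfolding convexity_bound_def rayleigh_dsum_eq[OF nu] \<rho>_def[symmetric] using R nu
    by (simp add: field_simps power2_eq_square)
  also have "\<dots> \<le> 1 / 2 * (\<nu> - \<rho> 1)" using ineq by linarith
  finally show "convexity_bound \<nu> \<le> 1 / 2" using R by (simp add: mult_le_cancel_right)
qed

section \<open>Negative orders\<close>

text \<open>At negative arguments the alternating signs cancel, as in the modified Bessel function;
  so Phi(z^2) has no zeros on the imaginary axis, whatever the order above -1.\<close>

lemma bessel_phi_neg:
  assumes "\<nu> > -1" "t \<ge> 0"
  obtains u v :: real where "bessel_phi \<nu> (- of_real t) = of_real u" "bessel_phi' \<nu> (- of_real t) = of_real v"
    "u > 0" "v \<le> 0"
proof -
  have pos: "(- 1) ^ n * bessel_coeff \<nu> n \<ge> 0" for n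
    using assms pochhammer_nonneg[of "\<nu> + 1" n] unfolding bessel_coeff_def
    by (simp flip: power_mult_distrib)
  define cu where "cu n = (-1) ^ n * bessel_coeff \<nu> n * t ^ n" for n
  define cv where "cv n = - (real (Suc n) * ((-1) ^ Suc n * bessel_coeff \<nu> (Suc n)) * t ^ n)" for n
  have minus: "(- complex_of_real t) ^ n = of_real ((-1) ^ n * t ^ n)" for n
    by (metis mult_minus1 of_real_minus of_real_power power_mult_distrib)
  have u: "(\<lambda>n. complex_of_real (cu n)) sums bessel_phi \<nu> (- of_real t)"
    using bessel_phi_sums[OF assms(1), of "- of_real t"] unfolding minus by (simp add: cu_def mult_ac)
  have v: "(\<lambda>n. complex_of_real (cv n)) sums bessel_phi' \<nu> (- of_real t)"
    using bessel_phi'_sums[OF assms(1), of "- of_real t"] unfolding minus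
    by (simp add: cv_def mult_ac del: of_nat_Suc)
  have u': "cu sums Re (bessel_phi \<nu> (- of_real t))" using sums_Re[OF u] by simp
  have v': "cv sums Re (bessel_phi' \<nu> (- of_real t))" using sums_Re[OF v] by simp
  show ?thesis
  proof
    show "bessel_phi \<nu> (- of_real t) = of_real (Re (bessel_phi \<nu> (- of_real t)))"
      using u u' by (metis sums_of_real_iff sums_unique2)
    show "bessel_phi' \<nu> (- of_real t) = of_real (Re (bessel_phi' \<nu> (- of_real t)))"
      using v v' by (metis sums_of_real_iff sums_unique2)
    have cu: "cu n \<ge> 0" for n using pos[of n] assms by (simp add: cu_def)
    have "(\<Sum>n. cu n) > 0"
      by (rule suminf_pos2[where i = 0]) (use u' cu in \<open>auto simp: sums_iff cu_def[of 0]\<close>)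
    then show "Re (bessel_phi \<nu> (- of_real t)) > 0" using u' by (simp add: sums_iff)
    have "cv n \<le> 0" for n
      using pos[of "Suc n"] assms unfolding cv_def by (simp del: power_Suc of_nat_Suc)
    then show "Re (bessel_phi' \<nu> (- of_real t)) \<le> 0"
      using sums_le[OF _ v' sums_zero] by blast
  qed
qed

text \<open>At z = \<i> sqrt t the quantity P is N t. It is nonpositive, starts at 0 and cannot
  reach \<nu>, so 0 < N t - \<nu> < 1. Then (1 - 1/\<nu>) N t \<le> 0 and (t + \<nu> N t)/(N t -
  \<nu>) \<ge> t, whence Re (z f''/f') \<le> -t.\<close>

lemma bessel_f_not_uniformly_convex_neg:
  assumes nu: "-1 < \<nu>" "\<nu> < 0" and bf: "is_bessel_f \<nu> f"
  shows "\<not> uniformly_convex f"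
proof
  assume uc: "uniformly_convex f"
  have holf: "f holomorphic_on ball 0 1" and inj: "inj_on f (ball 0 1)" and f0: "f 0 = 0"
    using uc by (auto simp: uniformly_convex_def)
  have nu': "\<nu> \<noteq> 0" using nu by simp
  define N where "N t = Re (- 2 * (- of_real t) * bessel_phi' \<nu> (- of_real t) / bessel_phi \<nu> (- of_real t))" for t
  have phi_nz: "bessel_phi \<nu> (- of_real t) \<noteq> 0" if "t \<ge> 0" for t
    using bessel_phi_neg[OF nu(1) that] by (metis less_irrefl of_real_eq_0_iff)
  have cont: "continuous_on {0..} N"
    unfolding N_def[abs_def] using phi_nz by (intro continuous_intros nu) auto
  have N_nonpos: "N t \<le> 0"
    and N_eq: "of_real (N t) * bessel_phi \<nu> (- of_real t) = - 2 * (- of_real t) * bessel_phi' \<nu> (- of_real t)"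
    if t: "t \<ge> 0" for t
  proof -
    obtain u v where uv: "bessel_phi \<nu> (- of_real t) = of_real u" "bessel_phi' \<nu> (- of_real t) = of_real v"
      "u > 0" "v \<le> 0" using bessel_phi_neg[OF nu(1) t] by metis
    have "N t = 2 * t * v / u" unfolding N_def uv by (simp flip: of_real_mult of_real_divide)
    moreover have "t * v \<le> 0" using t uv by (simp add: mult_nonneg_nonpos)
    ultimately show "N t \<le> 0" "of_real (N t) * bessel_phi \<nu> (- of_real t) = - 2 * (- of_real t) * bessel_phi' \<nu> (- of_real t)"
      using uv by (auto simp: divide_nonpos_pos mult.assoc)
  qed
  have main: "N t \<noteq> \<nu>" "(1 - 1 / \<nu>) * N t - (- t - \<nu> * N t) / (\<nu> - N t) \<ge> - 1 / 2" if t: "0 < t" "t < 1" for t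
  proof -
    define z where "z = \<i> * complex_of_real (sqrt t)"
    have z: "z \<in> ball 0 1" "z \<noteq> 0" "z\<^sup>2 = - of_real t"
      using t by (auto simp: z_def norm_mult power_mult_distrib simp flip: of_real_power)
    have P: "of_real (N t) * bessel_phi \<nu> (z\<^sup>2) = - 2 * z\<^sup>2 * bessel_phi' \<nu> (z\<^sup>2)"
      unfolding z(3) using N_eq t by simp
    have nz: "f z \<noteq> 0" "deriv f z \<noteq> 0" "bessel_phi \<nu> (z\<^sup>2) \<noteq> 0"
      using inj_onD[OF inj, of z 0] z f0 holomorphic_injective_imp_regular[OF holf open_ball inj z(1)]
        phi_nz[of t] t by (auto simp: z(3))
    note d = bessel_f_deriv2[OF nu(1) nu' bf z(1,2) nz P]
    show "N t \<noteq> \<nu>" using d(1) by auto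
    have "z * (deriv (deriv f) z / deriv f z) = of_real ((1 - 1 / \<nu>) * N t - (- t - \<nu> * N t) / (\<nu> - N t))"
      unfolding d(2) z(3) by simp
    then show "(1 - 1 / \<nu>) * N t - (- t - \<nu> * N t) / (\<nu> - N t) \<ge> - 1 / 2"
      using uniformly_convexD[OF uc z(1,2)] by (simp only: Re_complex_of_real)
  qed
  \<comment> \<open>Any t between 1/2 and 1 contradicts the lower bound -1/2.\<close>
  define t :: real where "t = 3 / 4"
  have t: "0 < t" "t < 1" by (auto simp: t_def)
  have N: "N t > \<nu>"
  proof (rule ccontr)
    assume "\<not> N t > \<nu>"
    moreover have "N 0 = 0" by (simp add: N_def)
    moreover have "continuous_on {0..t} N" using cont by (rule continuous_on_subset) auto
    ultimately obtain x where "0 \<le> x" "x \<le> t" "N x = \<nu>"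
      using IVT2'[of N t \<nu> 0] nu t by auto
    moreover have "x \<noteq> 0" using \<open>N 0 = 0\<close> \<open>N x = \<nu>\<close> nu by auto
    ultimately show False using main(1)[of x] t by auto
  qed
  have "(1 - 1 / \<nu>) * N t \<le> 0"
    using N_nonpos[of t] t nu by (intro mult_nonneg_nonpos) (auto simp: divide_nonneg_neg)
  moreover have "(- t - \<nu> * N t) / (\<nu> - N t) \<ge> t"
  proof -
    have "\<nu> * N t \<ge> 0" using nu N_nonpos[of t] t by (simp add: mult_nonpos_nonpos)
    moreover have "t * (N t - \<nu>) \<le> t * 1" using t N_nonpos[of t] nu by (intro mult_left_mono) auto
    moreover have "(- t - \<nu> * N t) / (\<nu> - N t) = (t + \<nu> * N t) / (N t - \<nu>)"
      using N by (simp add: divide_simps) (simp add: algebra_simps)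
    ultimately show ?thesis using N by (simp add: pos_le_divide_eq)
  qed
  moreover have "t > 1 / 2" by (simp add: t_def)
  ultimately show False using main(2)[OF t] by linarith
qed

theorem theorem3p4:
  shows "\<exists>\<nu>star \<nu>1 :: real.
    \<nu>star > -1 \<and> deriv (bessel_J \<nu>star) 1 = 0 \<and>
    (\<forall>\<nu>>-1. deriv (bessel_J \<nu>) 1 = 0 \<longrightarrow> \<nu> = \<nu>star) \<and>
    \<bar>\<nu>star - 0.39001\<bar> \<le> 0.000005 \<and>
    \<nu>1 > \<nu>star \<and> nu1_equation \<nu>1 \<and>
    (\<forall>\<nu>>\<nu>star. nu1_equation \<nu> \<longrightarrow> \<nu> = \<nu>1) \<and>
    \<bar>\<nu>1 - 1.4426\<bar> \<le> 0.00005 \<and>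
    (\<forall>\<nu>>-1. \<nu> \<noteq> 0 \<longrightarrow>
       ((\<exists>f. is_bessel_f \<nu> f \<and> uniformly_convex f) \<longleftrightarrow> \<nu> \<ge> \<nu>1))"
proof -
  have cont_R: "continuous_on A (\<lambda>\<nu>. rayleigh_sum \<nu> 1)" if "A \<subseteq> {0<..}" for A
    using that by (rule continuous_on_rayleigh_sum_order)
  \<comment> \<open>The intermediate value theorem on this interval yields existence and the stated
    accuracy together.\<close>
  obtain \<nu>star where s: "\<nu>star \<in> {0.390005..0.390015}" "rayleigh_sum \<nu>star 1 = \<nu>star"
  proof -
    have "continuous_on {0.390005..0.390015} (\<lambda>\<nu>. \<nu> - rayleigh_sum \<nu> 1)"
      by (intro continuous_intros cont_R) auto
    then have "\<exists>x\<ge>0.390005. x \<le> 0.390015 \<and> x - rayleigh_sum x 1 = 0"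
      using rayleigh_sum_numeric(1,2) by (intro IVT') auto
    then show ?thesis using that by auto
  qed
  then have s0: "\<nu>star > 0" by auto
  \<comment> \<open>\<nu> - P(1) is strictly increasing and vanishes at \<open>\<nu>star\<close>, so
    it has the sign of \<nu> - \<open>\<nu>star\<close>.\<close>
  have R_less: "rayleigh_sum \<nu> 1 < \<nu> \<longleftrightarrow> \<nu> > \<nu>star" if "\<nu> > 0" for \<nu>
    using rayleigh_sum_antimono[of \<nu> \<nu>star] rayleigh_sum_antimono[of \<nu>star \<nu>] s(2) s0 that
    by (cases \<nu> \<nu>star rule: linorder_cases) auto
  have R_eq: "rayleigh_sum \<nu> 1 = \<nu> \<longleftrightarrow> \<nu> = \<nu>star" if "\<nu> > 0" for \<nu>
    using rayleigh_sum_antimono[of \<nu> \<nu>star] rayleigh_sum_antimono[of \<nu>star \<nu>] s(2) s0 that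
    by (cases \<nu> \<nu>star rule: linorder_cases) auto
  obtain \<nu>1 where n1: "\<nu>1 \<in> {1.44255..1.44265}" "convexity_bound \<nu>1 = 1 / 2"
  proof -
    have R: "rayleigh_sum \<nu> 1 < \<nu>" if "\<nu> \<in> {1.44255..1.44265}" for \<nu>
      using R_less[of \<nu>] that s(1) by auto
    \<comment> \<open>The closed form of C depends on the order only through \<nu> and P(1), so
      continuity of P(1) suffices.\<close>
    have "continuous_on {1.44255..1.44265} (\<lambda>\<nu>. 1 - (\<nu>\<^sup>2 - 1) / (\<nu> - rayleigh_sum \<nu> 1)
        - (1 / \<nu> - 1) * (\<nu> - rayleigh_sum \<nu> 1))"
      by (intro continuous_intros cont_R) (use R in fastforce)+
    then have "continuous_on {1.44255..1.44265} convexity_bound"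
      by (rule continuous_on_eq) (use R in \<open>auto simp: convexity_bound_eq\<close>)
    then have "\<exists>x\<ge>1.44255. x \<le> 1.44265 \<and> convexity_bound x = 1 / 2"
      using convexity_bound_numeric by (intro IVT2') auto
    then show ?thesis using that by auto
  qed
  have n1s: "\<nu>1 > \<nu>star" using n1(1) s(1) by auto
  \<comment> \<open>Above \<open>\<nu>star\<close> the denominator of C is positive and C is
    strictly decreasing.\<close>
  have bound_iff: "convexity_bound \<nu> \<le> 1 / 2 \<longleftrightarrow> \<nu> \<ge> \<nu>1" "convexity_bound \<nu> = 1 / 2 \<longleftrightarrow> \<nu> = \<nu>1"
    if "\<nu> > \<nu>star" for \<nu>
    using convexity_bound_antimono[of \<nu> \<nu>1] convexity_bound_antimono[of \<nu>1 \<nu>] n1(2) n1s that s0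
      R_less[of \<nu>] R_less[of \<nu>1]
    by (cases \<nu> \<nu>1 rule: linorder_cases; simp)+
  show ?thesis
  proof (rule exI[of _ \<nu>star], rule exI[of _ \<nu>1], intro conjI allI impI)
    show "deriv (bessel_J \<nu>star) 1 = 0" using deriv_bessel_J_1_eq_0_iff[OF s0] s(2) by simp
    show "\<nu> = \<nu>star" if "-1 < \<nu>" "deriv (bessel_J \<nu>) 1 = 0" for \<nu>
      using that deriv_bessel_J_1_nz[of \<nu>] deriv_bessel_J_1_eq_0_iff[of \<nu>] R_eq[of \<nu>]
      by (cases "\<nu> > 0") auto
    show "nu1_equation \<nu>1"
      using nu1_equation_iff[of \<nu>1] n1 n1s s0 R_less[of \<nu>1] by simp
    show "\<nu> = \<nu>1" if "\<nu> > \<nu>star" "nu1_equation \<nu>" for \<nu>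
      using nu1_equation_iff[of \<nu>] that s0 R_less[of \<nu>] bound_iff(2)[of \<nu>] by simp
    show "\<bar>\<nu>star - 0.39001\<bar> \<le> 0.000005" unfolding abs_le_iff using s(1) by auto
    show "\<bar>\<nu>1 - 1.4426\<bar> \<le> 0.00005" unfolding abs_le_iff using n1(1) by auto
    show "(\<exists>f. is_bessel_f \<nu> f \<and> uniformly_convex f) \<longleftrightarrow> \<nu> \<ge> \<nu>1" if "\<nu> > -1" "\<nu> \<noteq> 0" for \<nu>
    proof (cases "\<nu> > 0")
      case True
      have "(\<exists>f. is_bessel_f \<nu> f \<and> uniformly_convex f) \<longleftrightarrow> rayleigh_sum \<nu> 1 < \<nu> \<and> convexity_bound \<nu> \<le> 1 / 2"
        using bessel_f_exists_uniformly_convex[OF True] bessel_f_uniformly_convexD[OF True] by blast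
      also have "\<dots> \<longleftrightarrow> \<nu> \<ge> \<nu>1"
        using R_less[OF True] bound_iff(1)[of \<nu>] n1s by auto
      finally show ?thesis .
    next
      case False
      then show ?thesis using bessel_f_not_uniformly_convex_neg[of \<nu>] that s0 n1s by auto
    qed
  qed (use s0 n1s in auto)
qed

end
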